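(* Let $Q\subset\mathbb{R}^{d+1}$ be an open set with coordinates $x=(x_0,x_1,\dots,x_d)$, and let $\mathcal M\subset\mathbb{R}^k$ be a bounded open convex set. For $i=0,1,\dots,d$ let $A_i\in C^2(\mathcal M;\mathbb{R}^l)$. Let $u:Q\to\mathcal M$ be a weak solution of the system of conservation laws $$\sum_{i=0}^d \partial_{x_i}A_i(u)=0 \quad\text{in } Q,$$ i.e. $\sum_{i=0}^d\int_Q \partial_{x_i}\psi(x)\cdot A_i(u(x))\,dx=0$ for every $\psi\in C_c^\infty(Q;\mathbb{R}^l)$. Suppose that $B:\mathcal M\to\mathcal L(\mathbb{R}^l;\mathbb{R})$, written as a row vector $B(u)=(b_1(u),\dots,b_l(u))$, is a $C^1$ map which is a generalized entropy, i.e. for every $i=0,1,\dots,d$ there exists a $C^2$ function $q_i:\mathcal M\to\mathbb{R}$ with $$B(u)\cdot\nabla_u A_i(u)=\nabla_u q_i(u)\qquad\text{for all } u\in\mathcal M.$$ Assume moreover that for every compact $\mathcal K\subset Q$ there exists $\alpha>\tfrac13$ (possibly depending on $\mathcal K$) such that $u\in C^{0,\alpha}(\mathcal K)$. Then $$\sum_{i=0}^d\partial_{x_i}q_i(u)=0\quad\text{in }\mathcal D'(Q),$$ i.e. $\sum_{i=0}^d\int_Q\partial_{x_i}\phi(x)\,q_i(u(x))\,dx=0$ for every $\phi\in C_c^\infty(Q)$.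
   Context: $\nabla_u A_i(u)$ denotes the $l\times k$ Jacobian matrix of $A_i$ at $u$, and $\nabla_u q_i(u)$ the gradient of $q_i$ written as a row vector of length $k$; the product $B(u)\cdot\nabla_uA_i(u)$ is the row vector $\big(\sum_{j=1}^l b_j(u)\,\partial A_i^j/\partial u_\beta\big)_{\beta=1,\dots,k}$, where $A_i^j$ is the $j$-th component of $A_i$. $C^{0,\alpha}(\mathcal K)$ denotes the space of $\alpha$-Hölder continuous functions on $\mathcal K$. *)

theory Defs
  imports "HOL-Analysis.Analysis"
begin

definition partial_deriv :: "'n::finite \<Rightarrow> (real^'n \<Rightarrow> 'b::real_normed_vector) \<Rightarrow> real^'n \<Rightarrow> 'b" where
  "partial_deriv i f x = vector_derivative (\<lambda>t. f (x + t *\<^sub>R axis i 1)) (at 0)"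

definition smooth_fun :: "(real^'n::finite \<Rightarrow> 'b::real_normed_vector) \<Rightarrow> bool" where
  "smooth_fun f \<longleftrightarrow>
     (\<forall>js :: 'n list. continuous_on UNIV (foldr partial_deriv js f) \<and>
        (\<forall>i x. (\<lambda>t. foldr partial_deriv js f (x + t *\<^sub>R axis i 1)) differentiable (at 0)))"

definition fun_support :: "('a::topological_space \<Rightarrow> 'b::zero) \<Rightarrow> 'a set" where
  "fun_support f = closure {x. f x \<noteq> 0}"

definition test_fun :: "(real^'n::finite) set \<Rightarrow> (real^'n \<Rightarrow> 'b::real_normed_vector) \<Rightarrow> bool" where
  "test_fun Q f \<longleftrightarrow> smooth_fun f \<and> compact (fun_support f) \<and> fun_support f \<subseteq> Q"

definition C1_on :: "'a::real_normed_vector set \<Rightarrow> ('a \<Rightarrow> 'b::real_normed_vector) \<Rightarrow> bool" where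
  "C1_on S f \<longleftrightarrow> (\<exists>f' :: 'a \<Rightarrow> 'a \<Rightarrow>\<^sub>L 'b.
      (\<forall>x\<in>S. (f has_derivative blinfun_apply (f' x)) (at x)) \<and> continuous_on S f')"

definition C2_on :: "'a::real_normed_vector set \<Rightarrow> ('a \<Rightarrow> 'b::real_normed_vector) \<Rightarrow> bool" where
  "C2_on S f \<longleftrightarrow> (\<exists>f' :: 'a \<Rightarrow> 'a \<Rightarrow>\<^sub>L 'b.
      (\<forall>x\<in>S. (f has_derivative blinfun_apply (f' x)) (at x)) \<and> C1_on S f')"

definition holder_on :: "real \<Rightarrow> 'a::metric_space set \<Rightarrow> ('a \<Rightarrow> 'b::metric_space) \<Rightarrow> bool" where
  "holder_on \<alpha> K f \<longleftrightarrow> (\<exists>C. \<forall>x\<in>K. \<forall>y\<in>K. dist (f x) (f y) \<le> C * dist x y powr \<alpha>)"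

end

(*
  Fix phi with support K and mollify: v = eta_eps * U, where U is a continuous extension of u
  (restricted to a compact neighbourhood K' of K) with values in the convex hull C of u(K'), a compact
  subset of M. The weak formulation is tested with psi = eta_eps * (phi B(v)), so that
      sum_i int D_i (phi B(v)) . (eta_eps * A_i(U)) = 0,
  whereas the chain rule and one integration by parts give
      int D_i (phi B(v)) . A_i(v) = int D_i phi q_i(v).
  The difference is controlled by the commutator eta_eps * A_i(U) - A_i(v), which is O(eps^(2 alpha))
  because the first-order Taylor term is averaged away, times |D_i (phi B(v))| = O(eps^(alpha - 1)).
  The product O(eps^(3 alpha - 1)) vanishes as eps tends to 0 exactly when alpha > 1/3.
*)
theory Submission
  imports Defs
begin

section \<open>Compactly supported continuous functions and partial derivatives\<close>

text \<open>Two gaps in regularity shape the argument. \<open>B\<close> is only C^1, so phi B(v) is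
  not an admissible test function; the outer mollification repairs this, and since the kernel is
  even, Fubini moves it onto A_i(U), which is what creates the commutator. Moreover \<open>u\<close>
  is controlled only on compact subsets of Q, and its values lie in an open set \<open>M\<close> on
  which the derivatives of A_i, B and q_i may be unbounded; the extension U removes both obstacles,
  because the compact convex set C contains all values of U and of its averages. The factor
  eps^(alpha - 1) arises because the gradient of the kernel has mean zero and L^1 norm O(1/eps), so
  that it sees only the oscillation of U. The linear Taylor term averages away because the expansion
  is made at v(x), the exact average of U around x. All intermediate integrals are gauge integrals
  of compactly supported continuous functions: integrability is then automatic, and integration by
  parts reduces to translation invariance. Lebesgue integrals over Q occur only in the weak
  formulation and in the conclusion.\<close>

definition ccont :: "('a::euclidean_space \<Rightarrow> 'b::banach) \<Rightarrow> bool" where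
  "ccont g \<longleftrightarrow> continuous_on UNIV g \<and> (\<exists>R. \<forall>x. R < norm x \<longrightarrow> g x = 0)"

text \<open>\<open>partial_deriv\<close> is total and carries no information where the derivative
  fails to exist. This relation asserts existence and value together, and so can be composed by the
  rules of calculus.\<close>

definition has_partial :: "'n::finite \<Rightarrow> (real^'n \<Rightarrow> 'b::real_normed_vector) \<Rightarrow> (real^'n \<Rightarrow> 'b) \<Rightarrow> bool" where
  "has_partial i f f' \<longleftrightarrow>
     (\<forall>x. ((\<lambda>t. f (x + t *\<^sub>R axis i 1)) has_vector_derivative f' x) (at 0))"

lemma ccontI: "continuous_on UNIV g \<Longrightarrow> (\<And>x. R < norm x \<Longrightarrow> g x = 0) \<Longrightarrow> ccont g"
  by (auto simp: ccont_def)

lemma ccont_continuous: "ccont g \<Longrightarrow> continuous_on S g"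
  using continuous_on_subset ccont_def by blast

lemma ex_cbox_norm_le: "\<exists>a b. \<forall>x::'a::euclidean_space. norm x \<le> R \<longrightarrow> x \<in> cbox a b"
proof -
  obtain a where "cball (0::'a) R \<subseteq> cbox (-a) a"
    using bounded_subset_cbox_symmetric[OF bounded_cball] by blast
  then show ?thesis by (intro exI[of _ "-a"] exI[of _ a]) (auto simp: subset_iff)
qed

lemma integral_UNIV_restrict:
  fixes g :: "'a::euclidean_space \<Rightarrow> 'b::banach"
  assumes "\<And>x. x \<notin> S \<Longrightarrow> g x = 0"
  shows "integral UNIV g = integral S g"
proof -
  have "g = (\<lambda>x. if x \<in> S then g x else 0)" using assms by auto
  then show ?thesis using integral_restrict_UNIV[of S g] by simp
qed

lemma ccont_integrable:
  assumes "ccont g" shows "g integrable_on UNIV"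
proof -
  obtain R where R: "\<And>x. R < norm x \<Longrightarrow> g x = 0" using assms by (auto simp: ccont_def)
  obtain a b where ab: "\<And>x::'a. norm x \<le> R \<Longrightarrow> x \<in> cbox a b" using ex_cbox_norm_le by metis
  have "g integrable_on cbox a b"
    by (rule integrable_continuous) (rule ccont_continuous[OF assms])
  then show ?thesis
    by (rule integrable_on_superset) (meson R ab not_le, simp)
qed

text \<open>Bridge from the Lebesgue integrals of the weak formulation to gauge integrals over the
  whole space. The integrand \<open>h\<close> has to agree with the well-behaved \<open>g\<close>
  only on \<open>Q\<close>, since nothing is known of \<open>u\<close> elsewhere.\<close>

lemma ccont_set_lebesgue_integral:
  fixes g :: "'a::euclidean_space \<Rightarrow> real"
  assumes "ccont g" "\<And>x. x \<notin> Q \<Longrightarrow> g x = 0" and eq: "\<And>x. x \<in> Q \<Longrightarrow> h x = g x"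
  shows "(LINT x:Q|lborel. h x) = integral UNIV g"
proof -
  obtain R where R: "\<And>x. R < norm x \<Longrightarrow> g x = 0" using assms by (auto simp: ccont_def)
  obtain a b where ab: "\<And>x::'a. norm x \<le> R \<Longrightarrow> x \<in> cbox a b" using ex_cbox_norm_le by metis
  have "integrable lborel (\<lambda>x. indicator (cbox a b) x *\<^sub>R g x)"
    by (rule borel_integrable_compact) (auto intro: ccont_continuous[OF assms(1)])
  moreover have "(\<lambda>x. indicator (cbox a b) x *\<^sub>R g x) = g"
    using R ab by (intro ext) (simp add: indicator_def, meson not_le)
  ultimately have "integrable lborel g" by simp
  then have "integral UNIV g = (LINT x|lborel. g x)" by (rule integral_lborel)
  moreover have "g = (\<lambda>x. indicator Q x *\<^sub>R h x)"
    using assms by (auto simp: indicator_def)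
  ultimately show ?thesis by (simp add: set_lebesgue_integral_def)
qed

lemma ccont_add: "ccont f \<Longrightarrow> ccont g \<Longrightarrow> ccont (\<lambda>x. f x + g x)"
  unfolding ccont_def
proof (elim conjE exE, intro conjI)
  fix R R' assume "\<forall>x. R < norm x \<longrightarrow> f x = 0" "\<forall>x. R' < norm x \<longrightarrow> g x = 0"
  then show "\<exists>R. \<forall>x. R < norm x \<longrightarrow> f x + g x = 0" by (intro exI[of _ "max R R'"]) auto
qed (auto intro: continuous_intros)

lemma ccont_sum: "finite I \<Longrightarrow> (\<And>i. i \<in> I \<Longrightarrow> ccont (f i)) \<Longrightarrow> ccont (\<lambda>x. \<Sum>i\<in>I. f i x)"
proof (induction I rule: finite_induct)
  case empty
  then show ?case by (auto simp: ccont_def)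
next
  case (insert i I)
  then show ?case by (simp add: ccont_add)
qed

text \<open>Bounded support is inherited from \<open>f\<close>; the typical use is a product in
  which one factor has compact support and the other is merely continuous.\<close>

lemma ccont_compose:
  assumes "ccont f" and cont: "continuous_on UNIV g" and zero: "\<And>x. f x = 0 \<Longrightarrow> g x = 0"
  shows "ccont g"
  using assms by (auto simp: ccont_def)

lemma norm_triangle_add_cancel: "norm (x::'a::real_normed_vector) \<le> norm (x + y) + norm y"
  using norm_triangle_ineq4[of "x + y" y] by simp

lemma ccont_affine:
  fixes f :: "'a::euclidean_space \<Rightarrow> 'b::banach" and m :: real and c :: "'a"
  assumes "ccont f" "m \<noteq> 0"
  shows "ccont (\<lambda>x::'a. f (m *\<^sub>R x + c))"
proof -
  obtain R where R: "\<And>x. R < norm x \<Longrightarrow> f x = 0" using assms by (auto simp: ccont_def)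
  show ?thesis
  proof (rule ccontI)
    show "continuous_on UNIV (\<lambda>x::'a. f (m *\<^sub>R x + c))"
      by (rule continuous_on_compose2[OF ccont_continuous[OF assms(1), of UNIV]])
        (auto intro!: continuous_intros)
    fix x :: 'a assume "(R + norm c) / \<bar>m\<bar> < norm x"
    then have "R + norm c < norm (m *\<^sub>R x)" using assms by (simp add: field_simps)
    also have "\<dots> \<le> norm (m *\<^sub>R x + c) + norm c" by (rule norm_triangle_add_cancel)
    finally show "f (m *\<^sub>R x + c) = 0" by (intro R) simp
  qed
qed

text \<open>Translation (\<open>m = 1\<close>), reflection (\<open>m = -1\<close>) and dilation
  (\<open>m = 1 / \<epsilon>\<close>) are all instances. The affine change of variables is applied
  on a box that contains the support.\<close>

lemma integral_affine:
  fixes f :: "'a::euclidean_space \<Rightarrow> 'b::banach" and m :: real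
  assumes "ccont f" "m \<noteq> 0"
  shows "integral UNIV (\<lambda>x::'a. f (m *\<^sub>R x + c)) = (1 / \<bar>m\<bar> ^ DIM('a)) *\<^sub>R integral UNIV f"
proof -
  obtain R where R: "\<And>x. R < norm x \<Longrightarrow> f x = 0" using assms by (auto simp: ccont_def)
  obtain a b where ab: "\<And>x::'a. norm x \<le> R \<Longrightarrow> x \<in> cbox a b" using ex_cbox_norm_le by metis
  have z: "f x = 0" if "x \<notin> cbox a b" for x using that R ab by (meson not_le)
  have "(f has_integral integral UNIV f) (cbox a b)"
    using integral_UNIV_restrict[of "cbox a b" f] z
      integrable_integral[OF integrable_continuous[OF ccont_continuous[OF assms(1)]], of a b] by simp
  from has_integral_affinity[OF this assms(2), of c]
  have "((\<lambda>x. f (m *\<^sub>R x + c)) has_integral (1 / \<bar>m\<bar> ^ DIM('a)) *\<^sub>R integral UNIV f) UNIV"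
  proof (rule has_integral_on_superset)
    fix x assume x: "x \<notin> (\<lambda>x. (1 / m) *\<^sub>R x + - ((1 / m) *\<^sub>R c)) ` cbox a b"
    have "x = (1 / m) *\<^sub>R (m *\<^sub>R x + c) + - ((1 / m) *\<^sub>R c)"
      using assms by (simp add: algebra_simps)
    with x have "m *\<^sub>R x + c \<notin> cbox a b" by blast
    then show "f (m *\<^sub>R x + c) = 0" by (rule z)
  qed auto
  then show ?thesis by (rule integral_unique)
qed

section \<open>Derivatives along coordinate axes and integration by parts\<close>

lemma has_partial_at:
  assumes "has_partial i f f'"
  shows "((\<lambda>t. f (x + t *\<^sub>R axis i 1)) has_vector_derivative f' (x + s *\<^sub>R axis i 1)) (at s)"
proof -
  have "((\<lambda>t. f ((x + s *\<^sub>R axis i 1) + t *\<^sub>R axis i 1)) has_vector_derivative f' (x + s *\<^sub>R axis i 1)) (at (s - s))"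
    using assms by (simp add: has_partial_def)
  then have "((\<lambda>t. f ((x + s *\<^sub>R axis i 1) + t *\<^sub>R axis i 1)) \<circ> (\<lambda>t. t - s) has_vector_derivative
      1 *\<^sub>R f' (x + s *\<^sub>R axis i 1)) (at s)"
    by (intro vector_diff_chain_at) (auto intro!: derivative_eq_intros)
  then show ?thesis by (simp add: o_def algebra_simps)
qed

lemma has_partial_unique: "has_partial i f f' \<Longrightarrow> partial_deriv i f = f'"
  unfolding has_partial_def partial_deriv_def by (intro ext vector_derivative_at) blast

text \<open>Differentiation is local, because the line through \<open>x\<close> stays in
  \<open>U\<close> for small parameters. In this form supports pass from functions to their partial
  derivatives.\<close>

lemma has_partial_zero:
  assumes "has_partial i f f'" "open U" "\<And>y. y \<in> U \<Longrightarrow> f y = 0" "x \<in> U"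
  shows "f' x = 0"
proof -
  have "continuous (at 0) (\<lambda>t. x + t *\<^sub>R axis i 1)" by (intro continuous_intros)
  then have "eventually (\<lambda>t. x + t *\<^sub>R axis i 1 \<in> U) (at 0)"
    using assms(2,4) unfolding continuous_at tendsto_def by auto
  then have "eventually (\<lambda>t. f (x + t *\<^sub>R axis i 1) = 0) (nhds (0::real))"
    unfolding eventually_nhds_conv_at using assms by (auto elim: eventually_mono)
  then have "((\<lambda>t. f (x + t *\<^sub>R axis i 1)) has_vector_derivative 0) (at 0)"
    using assms
    by (subst has_vector_derivative_cong_ev[where g = "\<lambda>t. 0"]) (auto elim: eventually_mono)
  moreover have "((\<lambda>t. f (x + t *\<^sub>R axis i 1)) has_vector_derivative f' x) (at 0)"
    using assms(1) by (simp add: has_partial_def)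
  ultimately show ?thesis by (rule vector_derivative_unique_at[symmetric])
qed

lemma has_partial_ccont:
  assumes "has_partial i f f'" "ccont f" "continuous_on UNIV f'"
  shows "ccont f'"
proof -
  obtain R where R: "\<And>x. R < norm x \<Longrightarrow> f x = 0" using assms(2) by (auto simp: ccont_def)
  have "open {x::real^'a. R < norm x}" by (intro open_Collect_less continuous_intros)
  from has_partial_zero[OF assms(1) this] R show ?thesis
    by (intro ccontI[OF assms(3), of R]) auto
qed

lemma continuous_on_UNIV_compose:
  assumes "continuous_on UNIV g" "continuous_on S p"
  shows "continuous_on S (\<lambda>z. g (p z))"
  using continuous_on_compose2[OF assms] by auto

text \<open>By translation invariance the integral of \<open>f\<close> shifted by t along the axis
  does not depend on t; differentiating it under the integral sign at t = 0 gives the integral of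
  \<open>f'\<close>. This is the only form of integration by parts needed: it is applied to suitable
  products.\<close>

lemma integral_partial_zero:
  fixes f :: "real^'n::finite \<Rightarrow> 'b::banach"
  assumes p: "has_partial i f f'" and f: "ccont f" and f': "continuous_on UNIV f'"
  shows "integral UNIV f' = 0"
proof -
  obtain R where R: "\<And>x. R < norm x \<Longrightarrow> f x = 0" using f by (auto simp: ccont_def)
  have R': "f' x = 0" if "R < norm x" for x
  proof -
    have "open {x::real^'n. R < norm x}" by (intro open_Collect_less continuous_intros)
    from has_partial_zero[OF p this] R that show ?thesis by auto
  qed
  \<comment> \<open>The margin 1 keeps the supports of all translates with |t| < 1 inside one fixed
    box, on which differentiation under the integral sign is possible.\<close>
  obtain a b where ab: "\<And>x::real^'n. norm x \<le> R + 1 \<Longrightarrow> x \<in> cbox a b" using ex_cbox_norm_le by metis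
  let ?g = "\<lambda>t::real. integral (cbox a b) (\<lambda>y. f (y + t *\<^sub>R axis i 1))"
  have "(?g has_vector_derivative integral (cbox a b) (\<lambda>y. f' (y + 0 *\<^sub>R axis i 1))) (at 0 within ball 0 1)"
  proof (rule leibniz_rule_vector_derivative)
    fix t :: real and y :: "real^'n"
    show "((\<lambda>t. f (y + t *\<^sub>R axis i 1)) has_vector_derivative f' (y + t *\<^sub>R axis i 1)) (at t within ball 0 1)"
      by (rule has_vector_derivative_at_within) (rule has_partial_at[OF p])
  next
    fix t :: real
    show "(\<lambda>y. f (y + t *\<^sub>R axis i 1)) integrable_on cbox a b"
      by (rule integrable_continuous, rule continuous_on_UNIV_compose[OF ccont_continuous[OF f]])
        (intro continuous_intros)
  next
    show "continuous_on (ball 0 1 \<times> cbox a b) (\<lambda>(t, y). f' (y + t *\<^sub>R axis i 1))"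
      unfolding split_beta by (rule continuous_on_UNIV_compose[OF f']) (intro continuous_intros)
  qed auto
  moreover have z: "f' y = 0" if "y \<notin> cbox a b" for y
  proof (rule R')
    have "R + 1 < norm y" using ab that by (meson not_le)
    then show "R < norm y" by simp
  qed
  ultimately have d: "(?g has_vector_derivative integral UNIV f') (at 0)"
    using integral_UNIV_restrict[of "cbox a b" f'] z by (simp add: at_within_open[OF _ open_ball])
  have c: "?g t = integral UNIV f" if "t \<in> ball 0 1" for t
  proof -
    have "f (y + t *\<^sub>R axis i 1) = 0" if "y \<notin> cbox a b" for y
    proof -
      have "R + 1 < norm y" using ab that by (meson not_le)
      also have "\<dots> \<le> norm (y + t *\<^sub>R axis i 1) + norm (t *\<^sub>R axis i (1::real) :: real^'n)"
        by (rule norm_triangle_add_cancel)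
      finally show ?thesis using \<open>t \<in> ball 0 1\<close> by (intro R) simp
    qed
    then have "?g t = integral UNIV (\<lambda>y. f (y + t *\<^sub>R axis i 1))"
      by (intro integral_UNIV_restrict[symmetric])
    also have "\<dots> = integral UNIV f"
      using integral_affine[OF f, of 1 "t *\<^sub>R axis i 1"] by simp
    finally show ?thesis .
  qed
  have "((\<lambda>t. integral UNIV f) has_vector_derivative integral UNIV f') (at 0)"
    by (rule has_vector_derivative_transform_within_open[OF d, of "ball 0 1"]) (auto simp: c)
  then show ?thesis
    by (rule vector_derivative_unique_at) (rule has_vector_derivative_const)
qed

section \<open>Convolution\<close>

definition conv :: "(real^'n::finite \<Rightarrow> real) \<Rightarrow> (real^'n \<Rightarrow> 'b::banach) \<Rightarrow> real^'n \<Rightarrow> 'b" where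
  "conv \<eta> f x = integral UNIV (\<lambda>y. \<eta> (x - y) *\<^sub>R f y)"

lemma ccont_reflect:
  fixes \<eta> :: "real^'n::finite \<Rightarrow> 'b::banach"
  assumes "ccont \<eta>" shows "ccont (\<lambda>y. \<eta> (x - y))"
  using ccont_affine[OF assms, of "-1" x] by simp

lemma integral_reflect_UNIV:
  fixes \<eta> :: "real^'n::finite \<Rightarrow> 'b::banach"
  assumes "ccont \<eta>" shows "integral UNIV (\<lambda>y. \<eta> (x - y)) = integral UNIV \<eta>"
  using integral_affine[OF assms, of "-1" x] by simp

lemma ccont_conv_integrand:
  fixes \<eta> :: "real^'n::finite \<Rightarrow> real" and f :: "real^'n \<Rightarrow> 'b::banach"
  assumes "ccont \<eta>" "continuous_on UNIV f"
  shows "ccont (\<lambda>y. \<eta> (x - y) *\<^sub>R f y)"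
  by (rule ccont_compose[OF ccont_reflect[OF assms(1), of x]])
    (auto intro!: continuous_on_scaleR assms ccont_continuous[OF ccont_reflect[OF assms(1), of x]])

lemmas conv_integrable = ccont_integrable[OF ccont_conv_integrand]

text \<open>Continuity of parameter integrals needs a domain independent of the parameter; as
  \<open>x\<close> ranges over a bounded set, the shifted supports of the kernel stay in one
  box.\<close>

lemma conv_eq_integral_cbox:
  fixes \<eta> :: "real^'n::finite \<Rightarrow> real" and f :: "real^'n \<Rightarrow> 'b::banach"
  assumes "ccont \<eta>"
  shows "\<exists>a b. \<forall>x\<in>ball x0 1. conv \<eta> f x = integral (cbox a b) (\<lambda>y. \<eta> (x - y) *\<^sub>R f y)"
proof -
  obtain R where R: "\<And>x. R < norm x \<Longrightarrow> \<eta> x = 0" using assms by (auto simp: ccont_def)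
  obtain a b where ab: "\<And>x::real^'n. norm x \<le> R + norm x0 + 1 \<Longrightarrow> x \<in> cbox a b"
    using ex_cbox_norm_le by metis
  show ?thesis
  proof (intro exI ballI)
    fix x assume x: "x \<in> ball x0 1"
    show "conv \<eta> f x = integral (cbox a b) (\<lambda>y. \<eta> (x - y) *\<^sub>R f y)"
      unfolding conv_def
    proof (rule integral_UNIV_restrict)
      fix y assume "y \<notin> cbox a b"
      then have "R + norm x0 + 1 < norm y" using ab by (meson not_le)
      moreover have "norm y \<le> norm (x - y) + norm x0 + norm (x0 - x)"
        using norm_triangle_ineq4[of "x0" "x0 - x"] norm_triangle_ineq4[of x "x - y"] by simp
      moreover have "norm (x0 - x) < 1" using x by (simp add: dist_norm)
      ultimately show "\<eta> (x - y) *\<^sub>R f y = 0" using R[of "x - y"] by simp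
    qed
  qed
qed

lemma continuous_on_conv:
  fixes \<eta> :: "real^'n::finite \<Rightarrow> real" and f :: "real^'n \<Rightarrow> 'b::banach"
  assumes \<eta>: "ccont \<eta>" and f: "continuous_on UNIV f"
  shows "continuous_on UNIV (conv \<eta> f)"
proof -
  have "continuous (at x0) (conv \<eta> f)" for x0
  proof -
    obtain a b where ab: "\<And>x. x \<in> ball x0 1 \<Longrightarrow>
      conv \<eta> f x = integral (cbox a b) (\<lambda>y. \<eta> (x - y) *\<^sub>R f y)"
      using conv_eq_integral_cbox[OF \<eta>] by blast
    have "continuous_on (ball x0 1) (\<lambda>x. integral (cbox a b) (\<lambda>y. \<eta> (x - y) *\<^sub>R f y))"
    proof (rule integral_continuous_on_param)
      show "continuous_on (ball x0 1 \<times> cbox a b) (\<lambda>(x, y). \<eta> (x - y) *\<^sub>R f y)"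
        unfolding split_beta
        by (intro continuous_on_scaleR continuous_on_UNIV_compose[OF ccont_continuous[OF \<eta>]]
            continuous_on_UNIV_compose[OF f] continuous_intros)
    qed
    then have "continuous_on (ball x0 1) (conv \<eta> f)"
      by (rule continuous_on_eq) (simp add: ab)
    then show ?thesis
      by (metis centre_in_ball continuous_on_eq_continuous_at open_ball zero_less_one)
  qed
  then show ?thesis by (simp add: continuous_on_eq_continuous_at)
qed

text \<open>All differentiation falls on the kernel, so \<open>f\<close> may be merely continuous.
  The Leibniz rule is applied on a fixed box that contains the supports of both kernels shifted by
  parameters |t| < 1.\<close>

lemma has_partial_conv_left:
  fixes \<eta> :: "real^'n::finite \<Rightarrow> real" and f :: "real^'n \<Rightarrow> 'b::banach"
  assumes \<eta>: "ccont \<eta>" and p: "has_partial i \<eta> \<eta>'" and \<eta>': "continuous_on UNIV \<eta>'"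
    and f: "continuous_on UNIV f"
  shows "has_partial i (conv \<eta> f) (conv \<eta>' f)"
  unfolding has_partial_def
proof
  fix x0 :: "real^'n"
  have c': "ccont \<eta>'" by (rule has_partial_ccont[OF p \<eta> \<eta>'])
  obtain R where R: "\<And>x. R < norm x \<Longrightarrow> \<eta> x = 0" using \<eta> by (auto simp: ccont_def)
  obtain R' where R': "\<And>x. R' < norm x \<Longrightarrow> \<eta>' x = 0" using c' by (auto simp: ccont_def)
  let ?R = "max R R'"
  obtain a b where ab: "\<And>x::real^'n. norm x \<le> ?R + norm x0 + 1 \<Longrightarrow> x \<in> cbox a b"
    using ex_cbox_norm_le by metis
  have big: "?R < norm (x0 + t *\<^sub>R axis i 1 - y)" if "y \<notin> cbox a b" "\<bar>t\<bar> < 1" for t y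
  proof -
    have "?R + norm x0 + 1 < norm y" using ab that by (meson not_le)
    also have "norm y \<le> norm (x0 + t *\<^sub>R axis i 1 - y) + norm x0 + \<bar>t\<bar>"
      using norm_triangle_ineq[of x0 "t *\<^sub>R axis i 1"]
        norm_triangle_ineq4[of "x0 + t *\<^sub>R axis i 1" "x0 + t *\<^sub>R axis i 1 - y"] by simp
    finally show ?thesis using that by linarith
  qed
  have eq: "conv \<eta> f (x0 + t *\<^sub>R axis i 1) = integral (cbox a b) (\<lambda>y. \<eta> (x0 + t *\<^sub>R axis i 1 - y) *\<^sub>R f y)"
    if "\<bar>t\<bar> < 1" for t
    unfolding conv_def by (rule integral_UNIV_restrict) (use big R that in auto)
  have eq': "conv \<eta>' f x0 = integral (cbox a b) (\<lambda>y. \<eta>' (x0 + 0 *\<^sub>R axis i 1 - y) *\<^sub>R f y)"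
    unfolding conv_def using big[of _ 0] R' by (subst integral_UNIV_restrict[of "cbox a b"]) auto
  have "((\<lambda>t. integral (cbox a b) (\<lambda>y. \<eta> (x0 + t *\<^sub>R axis i 1 - y) *\<^sub>R f y))
     has_vector_derivative conv \<eta>' f x0) (at 0 within ball 0 1)"
    unfolding eq'
  proof (rule leibniz_rule_vector_derivative)
    fix t :: real and y :: "real^'n"
    have "((\<lambda>t. \<eta> ((x0 - y) + t *\<^sub>R axis i 1)) has_vector_derivative \<eta>' ((x0 - y) + t *\<^sub>R axis i 1)) (at t within ball 0 1)"
      by (rule has_vector_derivative_at_within) (rule has_partial_at[OF p])
    from bounded_linear.has_vector_derivative[OF bounded_linear_scaleR_left this, of "f y"]
    show "((\<lambda>t. \<eta> (x0 + t *\<^sub>R axis i 1 - y) *\<^sub>R f y) has_vector_derivative \<eta>' (x0 + t *\<^sub>R axis i 1 - y) *\<^sub>R f y) (at t within ball 0 1)"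
      by (simp add: algebra_simps)
  next
    fix t :: real
    show "(\<lambda>y. \<eta> (x0 + t *\<^sub>R axis i 1 - y) *\<^sub>R f y) integrable_on cbox a b"
      by (intro integrable_continuous ccont_continuous[OF ccont_conv_integrand] \<eta> f)
  next
    show "continuous_on (ball 0 1 \<times> cbox a b) (\<lambda>(t, y). \<eta>' (x0 + t *\<^sub>R axis i 1 - y) *\<^sub>R f y)"
      unfolding split_beta
      by (intro continuous_on_scaleR continuous_on_UNIV_compose[OF \<eta>']
          continuous_on_UNIV_compose[OF f] continuous_intros)
  qed auto
  then have "((\<lambda>t. integral (cbox a b) (\<lambda>y. \<eta> (x0 + t *\<^sub>R axis i 1 - y) *\<^sub>R f y))
     has_vector_derivative conv \<eta>' f x0) (at 0)"
    by (simp add: at_within_open[OF _ open_ball])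
  then show "((\<lambda>t. conv \<eta> f (x0 + t *\<^sub>R axis i 1)) has_vector_derivative conv \<eta>' f x0) (at 0)"
    by (rule has_vector_derivative_transform_within_open[of _ _ _ "ball 0 1"]) (auto simp: eq)
qed

lemma has_partial_scaleR:
  fixes f :: "real^'n::finite \<Rightarrow> real"
  assumes "has_partial i f f'" "has_partial i g g'"
  shows "has_partial i (\<lambda>x. f x *\<^sub>R g x) (\<lambda>x. f x *\<^sub>R g' x + f' x *\<^sub>R g x)"
  unfolding has_partial_def
proof
  fix x
  have "((\<lambda>t. f (x + t *\<^sub>R axis i 1)) has_field_derivative f' x) (at 0)"
    using assms(1) by (simp add: has_partial_def has_real_derivative_iff_has_vector_derivative)
  from has_vector_derivative_scaleR[OF this, of "\<lambda>t. g (x + t *\<^sub>R axis i 1)" "g' x"] assms(2)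
  show "((\<lambda>t. f (x + t *\<^sub>R axis i 1) *\<^sub>R g (x + t *\<^sub>R axis i 1)) has_vector_derivative
      f x *\<^sub>R g' x + f' x *\<^sub>R g x) (at 0)"
    by (simp add: has_partial_def)
qed

lemma has_partial_reflect:
  assumes "has_partial i f f'"
  shows "has_partial i (\<lambda>y. f (x - y)) (\<lambda>y. - f' (x - y))"
  unfolding has_partial_def
proof
  fix y
  have "((\<lambda>t. f ((x - y) + t *\<^sub>R axis i 1)) has_vector_derivative f' (x - y)) (at (- 0))"
    using assms by (simp add: has_partial_def)
  then have "((\<lambda>t. f ((x - y) + t *\<^sub>R axis i 1)) \<circ> uminus has_vector_derivative (-1) *\<^sub>R f' (x - y)) (at 0)"
    by (intro vector_diff_chain_at) (auto intro!: derivative_eq_intros)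
  then show "((\<lambda>t. f (x - (y + t *\<^sub>R axis i 1))) has_vector_derivative - f' (x - y)) (at 0)"
    by (simp add: o_def algebra_simps)
qed

text \<open>The product of \<open>f\<close> with the reflected kernel has compact support, so its
  derivative integrates to zero; the minus sign from reflecting the kernel turns the product rule
  into this equality.\<close>

lemma conv_partial_swap:
  fixes \<eta> :: "real^'n::finite \<Rightarrow> real" and f :: "real^'n \<Rightarrow> 'b::banach"
  assumes \<eta>: "ccont \<eta>" and p: "has_partial i \<eta> \<eta>'" and \<eta>': "continuous_on UNIV \<eta>'"
    and f: "continuous_on UNIV f" and pf: "has_partial i f f'" and f': "continuous_on UNIV f'"
  shows "conv \<eta>' f x = conv \<eta> f' x"
proof -
  have c': "ccont \<eta>'" by (rule has_partial_ccont[OF p \<eta> \<eta>'])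
  have hp: "has_partial i (\<lambda>y. \<eta> (x - y) *\<^sub>R f y) (\<lambda>y. \<eta> (x - y) *\<^sub>R f' y + (- \<eta>' (x - y)) *\<^sub>R f y)"
    by (rule has_partial_scaleR[OF has_partial_reflect[OF p] pf])
  have "continuous_on UNIV (\<lambda>y. \<eta> (x - y) *\<^sub>R f' y + (- \<eta>' (x - y)) *\<^sub>R f y)"
    using ccont_continuous[OF ccont_conv_integrand[OF \<eta> f'], of UNIV x]
      ccont_continuous[OF ccont_conv_integrand[OF c' f], of UNIV x]
    by (auto intro!: continuous_on_diff)
  from integral_partial_zero[OF hp ccont_conv_integrand[OF \<eta> f] this]
  have "integral UNIV (\<lambda>y. \<eta> (x - y) *\<^sub>R f' y - \<eta>' (x - y) *\<^sub>R f y) = 0" by simp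
  then show ?thesis
    using conv_integrable[OF \<eta> f', of x] conv_integrable[OF c' f, of x]
    by (simp add: integral_diff conv_def)
qed

lemma conv_linear:
  assumes "ccont \<eta>" "continuous_on UNIV f" "bounded_linear L"
  shows "conv \<eta> (\<lambda>y. L (f y)) x = L (conv \<eta> f x)"
proof -
  interpret bounded_linear L by fact
  show ?thesis
    using integral_linear[OF conv_integrable[OF assms(1,2), of x] assms(3)]
    by (simp add: conv_def o_def scaleR)
qed

lemma conv_diff:
  assumes "ccont \<eta>" "continuous_on UNIV f" "continuous_on UNIV g"
  shows "conv \<eta> (\<lambda>y. f y - g y) x = conv \<eta> f x - conv \<eta> g x"
  using conv_integrable[OF assms(1,2), of x] conv_integrable[OF assms(1,3), of x]
  by (simp add: conv_def integral_diff scaleR_diff_right)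

lemma conv_const:
  fixes c :: "'b::euclidean_space"
  assumes "ccont \<eta>" shows "conv \<eta> (\<lambda>y. c) x = integral UNIV \<eta> *\<^sub>R c"
proof -
  have "((\<lambda>y. \<eta> (x - y) *\<^sub>R c) has_integral integral UNIV (\<lambda>y. \<eta> (x - y)) *\<^sub>R c) UNIV"
    by (intro has_integral_scaleR_left integrable_integral ccont_integrable ccont_reflect assms)
  then show ?thesis
    unfolding conv_def integral_reflect_UNIV[OF assms] by (rule integral_unique)
qed

text \<open>The L^1 norm of the kernel appears because the lemma also serves kernel derivatives,
  which change sign. The bound on \<open>f\<close> is required only where the kernel is nonzero, so
  a bound on a small ball is enough.\<close>

lemma norm_conv_le:
  assumes \<eta>: "ccont \<eta>" and f: "continuous_on UNIV f"
    and le: "\<And>y. \<eta> (x - y) \<noteq> 0 \<Longrightarrow> norm (f y) \<le> d"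
  shows "norm (conv \<eta> f x) \<le> integral UNIV (\<lambda>z. \<bar>\<eta> z\<bar>) * d"
proof -
  have a: "ccont (\<lambda>z. \<bar>\<eta> z\<bar>)"
    by (rule ccont_compose[OF \<eta>]) (auto intro!: continuous_intros ccont_continuous[OF \<eta>])
  have "norm (conv \<eta> f x) \<le> integral UNIV (\<lambda>y. \<bar>\<eta> (x - y)\<bar> * d)"
    unfolding conv_def
  proof (rule integral_norm_bound_integral)
    show "(\<lambda>y. \<bar>\<eta> (x - y)\<bar> * d) integrable_on UNIV"
      by (intro integrable_on_mult_left ccont_integrable ccont_reflect[OF a])
    show "norm (\<eta> (x - y) *\<^sub>R f y) \<le> \<bar>\<eta> (x - y)\<bar> * d" for y
      using le[of y] by (cases "\<eta> (x - y) = 0") (auto intro: mult_left_mono)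
  qed (rule conv_integrable[OF \<eta> f])
  also have "\<dots> = integral UNIV (\<lambda>z. \<bar>\<eta> z\<bar>) * d"
    using integral_reflect_UNIV[OF a, of x] by simp
  finally show ?thesis .
qed

lemma conv_eq_0: "(\<And>y. \<eta> (x - y) = 0 \<or> f y = 0) \<Longrightarrow> conv \<eta> f x = 0"
proof -
  assume "\<And>y. \<eta> (x - y) = 0 \<or> f y = 0"
  then have "(\<lambda>y. \<eta> (x - y) *\<^sub>R f y) = (\<lambda>y. 0)" by auto
  then show ?thesis by (simp add: conv_def)
qed

lemma ccont_conv:
  assumes \<eta>: "ccont \<eta>" and f: "ccont f" shows "ccont (conv \<eta> f)"
proof -
  obtain R where R: "\<And>x. R < norm x \<Longrightarrow> \<eta> x = 0" using \<eta> by (auto simp: ccont_def)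
  obtain S where S: "\<And>x. S < norm x \<Longrightarrow> f x = 0" using f by (auto simp: ccont_def)
  show ?thesis
  proof (rule ccontI)
    fix x :: "real^'a" assume x: "R + S < norm x"
    show "conv \<eta> f x = 0"
    proof (rule conv_eq_0)
      fix y
      have "norm x \<le> norm (x - y) + norm y" using norm_triangle_ineq[of "x - y" y] by simp
      then show "\<eta> (x - y) = 0 \<or> f y = 0" using R[of "x - y"] S[of y] x by linarith
    qed
  qed (intro continuous_on_conv \<eta> ccont_continuous f)
qed

text \<open>A value outside \<open>C\<close> could be strictly separated from \<open>C\<close> by a
  hyperplane; integrating the separating inequality against a nonnegative kernel of mass one gives a
  contradiction.\<close>

lemma conv_in_convex:
  fixes f :: "real^'n::finite \<Rightarrow> 'b::euclidean_space"
  assumes \<eta>: "ccont \<eta>" and nn: "\<And>z. 0 \<le> \<eta> z" and one: "integral UNIV \<eta> = 1"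
    and f: "continuous_on UNIV f" and C: "convex C" "closed C" and fC: "\<And>y. f y \<in> C"
  shows "conv \<eta> f x \<in> C"
proof (rule ccontr)
  assume "conv \<eta> f x \<notin> C"
  then obtain a b where ab: "a \<bullet> conv \<eta> f x < b" "\<And>v. v \<in> C \<Longrightarrow> b < a \<bullet> v"
    using separating_hyperplane_closed_point[OF C] by blast
  have cf: "continuous_on UNIV (\<lambda>y. a \<bullet> f y)" by (intro continuous_intros f)
  have "0 \<le> conv \<eta> (\<lambda>y. a \<bullet> f y - b) x"
    unfolding conv_def
  proof (rule Henstock_Kurzweil_Integration.integral_nonneg)
    show "(\<lambda>y. \<eta> (x - y) *\<^sub>R (a \<bullet> f y - b)) integrable_on UNIV"
      by (intro conv_integrable \<eta> continuous_intros f)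
    show "0 \<le> \<eta> (x - y) *\<^sub>R (a \<bullet> f y - b)" for y
      using nn ab(2)[OF fC[of y]] by simp
  qed
  also have "\<dots> = a \<bullet> conv \<eta> f x - b"
    using conv_diff[OF \<eta> cf continuous_on_const, of b x] conv_const[OF \<eta>, of b x] one
      conv_linear[OF \<eta> f bounded_linear_inner_right, of a x] by simp
  finally show False using ab(1) by simp
qed

text \<open>For an even kernel, convolution is its own adjoint. Fubini is applied on a box that
  contains the supports of \<open>g\<close> and of \<open>conv \<eta> g\<close>, where the integrand
  is jointly continuous.\<close>

lemma integral_conv_inner_swap:
  fixes \<eta> :: "real^'n::finite \<Rightarrow> real" and f g :: "real^'n \<Rightarrow> 'b::euclidean_space"
  assumes \<eta>: "ccont \<eta>" and even: "\<And>z. \<eta> (- z) = \<eta> z" and g: "ccont g" and f: "continuous_on UNIV f"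
  shows "integral UNIV (\<lambda>x. conv \<eta> g x \<bullet> f x) = integral UNIV (\<lambda>y. g y \<bullet> conv \<eta> f y)"
proof -
  obtain R where R: "\<And>x. R < norm x \<Longrightarrow> \<eta> x = 0" using \<eta> by (auto simp: ccont_def)
  obtain S where S: "\<And>x. S < norm x \<Longrightarrow> g x = 0" using g by (auto simp: ccont_def)
  \<comment> \<open>The maximum is taken because the bound \<open>R\<close> is arbitrary and
    possibly negative, so \<open>R + S\<close> need not dominate \<open>S\<close>.\<close>
  obtain a b where ab: "\<And>x::real^'n. norm x \<le> max S (R + S) \<Longrightarrow> x \<in> cbox a b"
    using ex_cbox_norm_le by metis
  have gc: "continuous_on UNIV g" by (rule ccont_continuous[OF g])
  have out: "S < norm y" "R + S < norm y" if "y \<notin> cbox a b" for y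
    using ab[of y] that by (meson max.strict_boundedE not_le)+
  have zero: "\<eta> (x - y) = 0 \<or> g y = 0" if "x \<notin> cbox a b" for x y
  proof -
    have "norm x \<le> norm (x - y) + norm y" using norm_triangle_ineq[of "x - y" y] by simp
    then show ?thesis using R[of "x - y"] S[of y] out[OF that] by linarith
  qed
  have e: "\<eta> (y - x) = \<eta> (x - y)" for x y using even[of "x - y"] by simp
  have "conv \<eta> g x \<bullet> f x = integral (cbox a b) (\<lambda>y. \<eta> (x - y) * (g y \<bullet> f x))" for x
  proof -
    have "conv \<eta> g x \<bullet> f x = conv \<eta> (\<lambda>y. g y \<bullet> f x) x"
      using conv_linear[OF \<eta> gc bounded_linear_inner_left, of "f x" x] by simp
    also have "\<dots> = integral (cbox a b) (\<lambda>y. \<eta> (x - y) * (g y \<bullet> f x))"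
      unfolding conv_def by (subst integral_UNIV_restrict[of "cbox a b"]) (use out S in auto)
    finally show ?thesis .
  qed
  moreover have "conv \<eta> g x = 0" if "x \<notin> cbox a b" for x
    using zero[OF that] by (rule conv_eq_0)
  ultimately have "integral UNIV (\<lambda>x. conv \<eta> g x \<bullet> f x) =
     integral (cbox a b) (\<lambda>x. integral (cbox a b) (\<lambda>y. \<eta> (x - y) * (g y \<bullet> f x)))"
    by (subst integral_UNIV_restrict[of "cbox a b"]) auto
  also have "\<dots> = integral (cbox a b) (\<lambda>y. integral (cbox a b) (\<lambda>x. \<eta> (x - y) * (g y \<bullet> f x)))"
  proof (rule integral_swap_continuous)
    show "continuous_on (cbox (a, a) (b, b)) (\<lambda>(x, y). \<eta> (x - y) * (g y \<bullet> f x))"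
      unfolding split_beta
      by (intro continuous_on_mult continuous_on_inner continuous_on_UNIV_compose[OF ccont_continuous[OF \<eta>]]
            continuous_on_UNIV_compose[OF f] continuous_on_UNIV_compose[OF gc] continuous_intros)
  qed
  also have "(\<lambda>y. integral (cbox a b) (\<lambda>x. \<eta> (x - y) * (g y \<bullet> f x))) = (\<lambda>y. g y \<bullet> conv \<eta> f y)"
  proof
    fix y
    have "g y \<bullet> conv \<eta> f y = conv \<eta> (\<lambda>x. g y \<bullet> f x) y"
      using conv_linear[OF \<eta> f bounded_linear_inner_right, of "g y" y] by simp
    also have "\<dots> = integral UNIV (\<lambda>x. \<eta> (x - y) * (g y \<bullet> f x))"
      by (simp add: conv_def e[of y])
    also have "\<dots> = integral (cbox a b) (\<lambda>x. \<eta> (x - y) * (g y \<bullet> f x))"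
      by (rule integral_UNIV_restrict) (use zero in fastforce)
    finally show "integral (cbox a b) (\<lambda>x. \<eta> (x - y) * (g y \<bullet> f x)) = g y \<bullet> conv \<eta> f y" ..
  qed
  also have "integral (cbox a b) (\<lambda>y. g y \<bullet> conv \<eta> f y) = integral UNIV (\<lambda>y. g y \<bullet> conv \<eta> f y)"
    by (rule integral_UNIV_restrict[symmetric]) (use out S in auto)
  finally show ?thesis .
qed

section \<open>Smoothness through iterated partial derivatives\<close>

lemma smooth_fun_has_partial:
  assumes "smooth_fun f"
  shows "has_partial i (foldr partial_deriv js f) (foldr partial_deriv (i # js) f)"
  using assms vector_derivative_works unfolding smooth_fun_def has_partial_def partial_deriv_def
  by force

lemma smooth_fun_continuous: "smooth_fun f \<Longrightarrow> continuous_on UNIV (foldr partial_deriv js f)"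
  by (simp add: smooth_fun_def)

lemma foldr_partial_ccont:
  fixes f :: "real^'n::finite \<Rightarrow> 'b::banach"
  assumes "smooth_fun f" "ccont f" shows "ccont (foldr partial_deriv js f)"
proof (induction js)
  case (Cons i js)
  then show ?case
    using has_partial_ccont[OF smooth_fun_has_partial[OF assms(1), of i js]]
      smooth_fun_continuous[OF assms(1), of "i # js"] by blast
qed (simp add: assms)

text \<open>\<open>smooth_fun\<close> speaks of iterated \<open>partial_deriv\<close> terms that are
  awkward to compute one at a time. It suffices to guess the whole family of iterated derivatives,
  indexed by lists; uniqueness of derivatives identifies it by induction.\<close>

lemma smooth_funI:
  assumes "\<And>js. continuous_on UNIV (F js)" "\<And>i js. has_partial i (F js) (F (i # js))" "f = F []"
  shows "smooth_fun f"
proof -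
  have F: "foldr partial_deriv js f = F js" for js
    by (induction js) (simp_all add: assms(3) has_partial_unique[OF assms(2)])
  show ?thesis
    using assms(1,2) unfolding smooth_fun_def F has_partial_def
    by (metis differentiableI_vector)
qed

lemma smooth_fun_conv:
  fixes \<eta> :: "real^'n::finite \<Rightarrow> real" and f :: "real^'n \<Rightarrow> 'b::banach"
  assumes "smooth_fun \<eta>" "ccont \<eta>" "continuous_on UNIV f"
  shows "smooth_fun (conv \<eta> f)"
proof (rule smooth_funI[where F = "\<lambda>js. conv (foldr partial_deriv js \<eta>) f"])
  show "has_partial i (conv (foldr partial_deriv js \<eta>) f) (conv (foldr partial_deriv (i # js) \<eta>) f)" for i js
    by (intro has_partial_conv_left foldr_partial_ccont smooth_fun_has_partial smooth_fun_continuous assms)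
qed (auto intro!: continuous_on_conv foldr_partial_ccont assms)

section \<open>Mollifiers\<close>

text \<open>The powers of 1/t are carried along because differentiating exp(-1/t) produces them; the
  linear span of the family is therefore closed under differentiation.\<close>

definition exp_bump :: "nat \<Rightarrow> real \<Rightarrow> real" where
  "exp_bump m t = (if 0 < t then (1 / t) ^ m * exp (- (1 / t)) else 0)"

lemma exp_bump_tendsto_0: "(exp_bump m \<longlongrightarrow> 0) (at 0)"
proof -
  have "((\<lambda>t. (1 / t) ^ m / exp (1 / t)) \<longlongrightarrow> 0) (at_right (0::real))"
    using filterlim_compose[OF tendsto_power_div_exp_0[of m] filterlim_inverse_at_top_right]
    by (simp add: inverse_eq_divide)
  moreover have "\<forall>\<^sub>F t in at_right 0. (1 / t) ^ m / exp (1 / t) = exp_bump m t"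
    using eventually_at_right_less[of 0]
    by (rule eventually_mono) (simp add: exp_bump_def exp_minus divide_inverse)
  ultimately have r: "(exp_bump m \<longlongrightarrow> 0) (at_right 0)"
    by (rule Lim_transform_eventually)
  have "\<forall>\<^sub>F t in at_left 0. 0 = exp_bump m t"
    unfolding eventually_at_left_field by (rule exI[of _ "-1"]) (auto simp: exp_bump_def)
  then have "(exp_bump m \<longlongrightarrow> 0) (at_left 0)"
    using Lim_transform_eventually tendsto_const by blast
  with r show ?thesis by (simp add: filterlim_at_split)
qed

lemma has_derivative_exp_bump:
  "(exp_bump m has_real_derivative exp_bump (m + 2) t - real m * exp_bump (m + 1) t) (at t)"
proof (cases t "0::real" rule: linorder_cases)
  case less
  have "((\<lambda>t. 0::real) has_real_derivative 0) (at t)" by simp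
  then have "(exp_bump m has_real_derivative 0) (at t)"
    by (rule DERIV_cong_ev[THEN iffD1, rotated -1])
      (use less in \<open>auto simp: exp_bump_def intro!: eventually_mono[OF eventually_nhds_in_open[of "{..<0}"]]\<close>)
  then show ?thesis using less by (simp add: exp_bump_def)
next
  case equal
  \<comment> \<open>As \<open>exp_bump m 0 = 0\<close>, the difference quotient at 0 equals
    \<open>exp_bump (m + 1) h\<close> for all nonzero h, so flatness at 0 is the preceding limit
    with exponent \<open>m + 1\<close>.\<close>
  have "((\<lambda>h. (exp_bump m (0 + h) - exp_bump m 0) / h) \<longlongrightarrow> 0) (at 0)"
    by (rule Lim_transform_eventually[OF exp_bump_tendsto_0[of "m + 1"]])
      (auto simp: exp_bump_def eventually_at_filter)
  then show ?thesis using equal by (simp add: DERIV_def exp_bump_def)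
next
  case greater
  have i: "((\<lambda>t. 1 / t) has_real_derivative - ((1 / t) * (1 / t))) (at t)"
    using greater by (auto intro!: derivative_eq_intros)
  have "((\<lambda>t. (1 / t) ^ m * exp (- (1 / t))) has_real_derivative
      (1 / t) ^ (m + 2) * exp (- (1 / t)) - real m * ((1 / t) ^ (m + 1) * exp (- (1 / t)))) (at t)"
    by (rule DERIV_cong[OF DERIV_mult[OF DERIV_power[OF i, of m] DERIV_fun_exp[OF DERIV_minus[OF i]]]])
      (cases m; simp add: algebra_simps)
  then have "(exp_bump m has_real_derivative
      (1 / t) ^ (m + 2) * exp (- (1 / t)) - real m * ((1 / t) ^ (m + 1) * exp (- (1 / t)))) (at t)"
    by (rule DERIV_cong_ev[THEN iffD1, rotated -1])
      (use greater in \<open>auto simp: exp_bump_def intro!: eventually_mono[OF eventually_nhds_in_open[of "{0<..}"]]\<close>)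
  then show ?thesis using greater by (simp add: exp_bump_def)
qed

text \<open>The point of this class is that it is closed under partial derivatives, so that its members are smooth.\<close>

inductive bump_algebra :: "(real^'n::finite \<Rightarrow> real) \<Rightarrow> bool" where
  base: "bump_algebra (\<lambda>x. exp_bump m (1 + a * x $ i))"
| const: "bump_algebra (\<lambda>x. c)"
| add: "bump_algebra f \<Longrightarrow> bump_algebra g \<Longrightarrow> bump_algebra (\<lambda>x. f x + g x)"
| mult: "bump_algebra f \<Longrightarrow> bump_algebra g \<Longrightarrow> bump_algebra (\<lambda>x. f x * g x)"

lemma has_partial_real_iff:
  "has_partial i f f' \<longleftrightarrow> (\<forall>x. ((\<lambda>t. f (x + t *\<^sub>R axis i 1)) has_real_derivative f' x) (at 0))"
  by (simp add: has_partial_def has_real_derivative_iff_has_vector_derivative)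

lemma bump_algebra_has_partial:
  "bump_algebra f \<Longrightarrow> \<exists>f'. bump_algebra f' \<and> has_partial j f f'"
proof (induction rule: bump_algebra.induct)
  case (base m a i)
  \<comment> \<open>\<open>axis j 1 $ i\<close> is the Kronecker delta, so \<open>d\<close> vanishes
    when the direction of differentiation is not the coordinate in question.\<close>
  define d where "d = a * axis j 1 $ i"
  let ?f' = "\<lambda>x::real^'a. d * (exp_bump (m + 2) (1 + a * x $ i) + (- real m) * exp_bump (m + 1) (1 + a * x $ i))"
  have "has_partial j (\<lambda>x. exp_bump m (1 + a * x $ i)) ?f'"
    unfolding has_partial_real_iff
  proof
    fix x :: "real^'a"
    have "((\<lambda>t. 1 + a * (x + t *\<^sub>R axis j 1) $ i) has_real_derivative d) (at 0)"
      unfolding d_def by (auto intro!: derivative_eq_intros)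
    from DERIV_chain2[OF has_derivative_exp_bump this, of m]
    show "((\<lambda>t. exp_bump m (1 + a * (x + t *\<^sub>R axis j 1) $ i)) has_real_derivative ?f' x) (at 0)"
      by (simp add: mult.commute)
  qed
  moreover have "bump_algebra ?f'" by (intro bump_algebra.intros)
  ultimately show ?case by blast
next
  case (const c)
  have "has_partial j (\<lambda>x. c) (\<lambda>x. 0)" by (simp add: has_partial_real_iff)
  then show ?case using bump_algebra.const by blast
next
  case (add f g)
  then obtain f' g' where d: "bump_algebra f'" "bump_algebra g'" "has_partial j f f'" "has_partial j g g'" by blast
  then have "has_partial j (\<lambda>x. f x + g x) (\<lambda>x. f' x + g' x)"
    by (auto simp: has_partial_real_iff intro!: DERIV_add)
  with d show ?case using bump_algebra.add by blast
next
  case (mult f g)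
  then obtain f' g' where d: "bump_algebra f'" "bump_algebra g'" "has_partial j f f'" "has_partial j g g'" by blast
  then have "has_partial j (\<lambda>x. f x * g x) (\<lambda>x. f x * g' x + f' x * g x)"
    using has_partial_scaleR[of j f f' g g'] by simp
  moreover have "bump_algebra (\<lambda>x. f x * g' x + f' x * g x)"
    by (intro bump_algebra.add bump_algebra.mult d mult.hyps)
  ultimately show ?case by blast
qed

lemma bump_algebra_continuous: "bump_algebra f \<Longrightarrow> continuous_on UNIV f"
proof (induction rule: bump_algebra.induct)
  case (base m a i)
  have "continuous_on UNIV (exp_bump m)"
    using has_derivative_exp_bump[of m] DERIV_isCont by (simp add: continuous_on_eq_continuous_at) blast
  then show ?case by (rule continuous_on_UNIV_compose) (intro continuous_intros)
qed (auto intro!: continuous_intros)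

lemma bump_algebra_smooth:
  assumes "bump_algebra f" shows "smooth_fun f"
proof (rule smooth_funI)
  have *: "bump_algebra (foldr partial_deriv js f)" for js
  proof (induction js)
    case (Cons i js)
    then show ?case using bump_algebra_has_partial[of _ i] has_partial_unique by force
  qed (simp add: assms)
  then show "continuous_on UNIV (foldr partial_deriv js f)" for js by (rule bump_algebra_continuous)
  show "has_partial i (foldr partial_deriv js f) (foldr partial_deriv (i # js) f)" for i js
    using bump_algebra_has_partial[OF *[of js], of i] has_partial_unique by force
qed simp

lemma bump_algebra_prod: "finite I \<Longrightarrow> (\<And>i. i \<in> I \<Longrightarrow> bump_algebra (f i)) \<Longrightarrow> bump_algebra (\<lambda>x. \<Prod>i\<in>I. f i x)"
proof (induction I rule: finite_induct)
  case empty
  then show ?case by (simp add: bump_algebra.const)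
next
  case (insert i I)
  then show ?case by (simp add: bump_algebra.mult)
qed

lemma has_partial_scale:
  fixes f :: "real^'n::finite \<Rightarrow> real" and s :: real
  assumes "has_partial i f f'"
  shows "has_partial i (\<lambda>x. c * f (s *\<^sub>R x)) (\<lambda>x. c * s * f' (s *\<^sub>R x))"
  unfolding has_partial_real_iff
proof
  fix x :: "real^'n"
  have "((\<lambda>t. f (s *\<^sub>R x + t *\<^sub>R axis i 1)) has_real_derivative f' (s *\<^sub>R x)) (at (s * 0))"
    using assms by (simp add: has_partial_real_iff)
  then have "((\<lambda>t. f (s *\<^sub>R x + (s * t) *\<^sub>R axis i 1)) has_real_derivative f' (s *\<^sub>R x) * s) (at 0)"
    by (rule DERIV_chain2[where g = "\<lambda>t. s * t"]) (auto intro!: derivative_eq_intros)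
  from DERIV_cmult[OF this, of c]
  show "((\<lambda>t. c * f (s *\<^sub>R (x + t *\<^sub>R axis i 1))) has_real_derivative c * s * f' (s *\<^sub>R x)) (at 0)"
    by (simp add: scaleR_add_right mult_ac)
qed

lemma smooth_fun_scale:
  fixes f :: "real^'n::finite \<Rightarrow> real" and s :: real
  assumes "smooth_fun f"
  shows "smooth_fun (\<lambda>x. c * f (s *\<^sub>R x))"
proof (rule smooth_funI[where F = "\<lambda>js x. c * s ^ length js * foldr partial_deriv js f (s *\<^sub>R x)"])
  fix i js
  show "continuous_on UNIV (\<lambda>x. c * s ^ length js * foldr partial_deriv js f (s *\<^sub>R x))"
    by (intro continuous_on_mult continuous_on_UNIV_compose[OF smooth_fun_continuous[OF assms]] continuous_intros)
  show "has_partial i (\<lambda>x. c * s ^ length js * foldr partial_deriv js f (s *\<^sub>R x))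
     (\<lambda>x. c * s ^ length (i # js) * foldr partial_deriv (i # js) f (s *\<^sub>R x))"
    using has_partial_scale[OF smooth_fun_has_partial[OF assms, of i js], of "c * s ^ length js" s]
    by (simp add: mult_ac)
qed simp

lemma exp_bump_0: "0 \<le> exp_bump 0 t" "exp_bump 0 t \<noteq> 0 \<longleftrightarrow> 0 < t"
  by (auto simp: exp_bump_def)

text \<open>A product of one-dimensional bumps. The factors are positive exactly for |x_i| < 1/N;
  with N the number of coordinates this cube lies in the unit ball of the l^1 norm, hence in the
  Euclidean one. Pairing the factors for x_i and -x_i makes the product even.\<close>

lemma ex_bump:
  "\<exists>\<rho>::real^'n::finite \<Rightarrow> real. smooth_fun \<rho> \<and> ccont \<rho> \<and> (\<forall>z. 0 \<le> \<rho> z) \<and> (\<forall>z. \<rho> (- z) = \<rho> z) \<and>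
     (\<forall>z. 1 < norm z \<longrightarrow> \<rho> z = 0) \<and> 0 < integral UNIV \<rho>"
proof -
  define N where "N = real CARD('n)"
  have N: "0 < N" by (simp add: N_def)
  define \<rho> :: "real^'n \<Rightarrow> real" where
    "\<rho> = (\<lambda>x. \<Prod>i\<in>UNIV. exp_bump 0 (1 + N * x $ i) * exp_bump 0 (1 + (- N) * x $ i))"
  have sm: "smooth_fun \<rho>"
    unfolding \<rho>_def by (intro bump_algebra_smooth bump_algebra_prod bump_algebra.intros) simp
  have nn: "0 \<le> \<rho> z" for z
    unfolding \<rho>_def by (intro prod_nonneg mult_nonneg_nonneg exp_bump_0 ballI)
  have z: "\<rho> x = 0" if x: "1 < norm x" for x
  proof (rule ccontr)
    assume "\<rho> x \<noteq> 0"
    then have "0 < 1 + N * x $ i" "0 < 1 + (- N) * x $ i" for i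
      unfolding \<rho>_def by (auto simp: exp_bump_0)
    then have "\<bar>x $ i\<bar> \<le> 1 / N" for i
      using N by (simp add: abs_le_iff field_simps) (smt (verit))
    then have "(\<Sum>i\<in>UNIV. \<bar>x $ i\<bar>) \<le> of_nat (card (UNIV :: 'n set)) * (1 / N)"
      by (intro sum_bounded_above) auto
    also have "\<dots> = 1" using N by (simp add: N_def)
    finally show False using norm_le_l1_cart[of x] x by simp
  qed
  have cc: "ccont \<rho>"
    using smooth_fun_continuous[OF sm, of "[]"] z by (intro ccontI[of _ 1]) auto
  have ev: "\<rho> (- x) = \<rho> x" for x
    unfolding \<rho>_def by (intro prod.cong) (auto simp: mult.commute)
  obtain a b where ab: "\<And>x::real^'n. norm x \<le> 1 \<Longrightarrow> x \<in> cbox a b" using ex_cbox_norm_le by metis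
  have eq: "integral UNIV \<rho> = integral (cbox a b) \<rho>"
    by (rule integral_UNIV_restrict) (use ab z in \<open>meson not_le\<close>)
  have "box a b \<noteq> {}"
  proof
    assume "box a b = {}"
    moreover have "ball 0 1 \<subseteq> cbox a b" using ab by auto
    then have "interior (ball 0 1) \<subseteq> interior (cbox a b)" by (rule interior_mono)
    ultimately show False by (simp add: interior_cbox)
  qed
  \<comment> \<open>A nonnegative continuous function with zero integral over a box with nonempty
    interior vanishes on that box, whereas every factor of \<open>\<rho> 0\<close> is the positive
    number \<open>exp_bump 0 1\<close>.\<close>
  have "integral UNIV \<rho> \<noteq> 0"
  proof
    assume "integral UNIV \<rho> = 0"
    then have "(\<rho> has_integral 0) (cbox a b)"
      using eq integrable_integral[OF integrable_continuous[OF ccont_continuous[OF cc]], of a b] by simp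
    from has_integral_0_cbox_imp_0[OF ccont_continuous[OF cc] _ this \<open>box a b \<noteq> {}\<close>, of 0] nn ab[of 0]
    have "\<rho> 0 = 0" by simp
    then show False by (simp add: \<rho>_def exp_bump_def)
  qed
  moreover have "0 \<le> integral UNIV \<rho>"
    by (intro Henstock_Kurzweil_Integration.integral_nonneg ccont_integrable cc nn)
  ultimately show ?thesis using sm cc nn ev z by (intro exI[of _ \<rho>]) auto
qed

text \<open>Dilations of one bump. The normalisation cancels the volume factor, so the L^1 norm of a
  partial derivative retains only the 1/\<epsilon> of the chain rule. The constant is chosen before
  \<open>\<epsilon>\<close>, and summing over all directions makes it independent of
  \<open>i\<close>.\<close>

lemma ex_mollifier:
  "\<exists>C\<ge>0. \<forall>\<epsilon>>0. \<exists>\<eta>::real^'n::finite \<Rightarrow> real. smooth_fun \<eta> \<and> ccont \<eta> \<and> (\<forall>z. 0 \<le> \<eta> z) \<and>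
     (\<forall>z. \<eta> (- z) = \<eta> z) \<and> (\<forall>z. \<epsilon> < norm z \<longrightarrow> \<eta> z = 0) \<and> integral UNIV \<eta> = 1 \<and>
     (\<forall>i. integral UNIV (\<lambda>z. \<bar>partial_deriv i \<eta> z\<bar>) \<le> C / \<epsilon>)"
proof -
  obtain \<rho> :: "real^'n \<Rightarrow> real" where sm: "smooth_fun \<rho>" and cc: "ccont \<rho>" and nn: "\<And>z. 0 \<le> \<rho> z"
    and ev: "\<And>z. \<rho> (- z) = \<rho> z" and z: "\<And>z. 1 < norm z \<Longrightarrow> \<rho> z = 0" and pos: "0 < integral UNIV \<rho>"
    using ex_bump by blast
  let ?I = "integral UNIV \<rho>"
  let ?J = "\<lambda>i. integral UNIV (\<lambda>z. \<bar>partial_deriv i \<rho> z\<bar>)"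
  let ?C = "(\<Sum>i\<in>UNIV. ?J i) / ?I"
  have ccp: "ccont (partial_deriv i \<rho>)" for i
    using foldr_partial_ccont[OF sm cc, of "[i]"] by simp
  have cca: "ccont (\<lambda>z. \<bar>partial_deriv i \<rho> z\<bar>)" for i
    by (rule ccont_compose[OF ccp[of i]]) (auto intro!: continuous_intros ccont_continuous[OF ccp])
  have J: "0 \<le> ?J i" for i
    by (intro Henstock_Kurzweil_Integration.integral_nonneg ccont_integrable cca) simp
  show ?thesis
  proof (intro exI[of _ ?C] conjI allI impI)
    show "0 \<le> ?C" using pos by (intro divide_nonneg_pos sum_nonneg J) auto
    fix \<epsilon> :: real assume e: "0 < \<epsilon>"
    define c where "c = 1 / (\<epsilon> ^ CARD('n) * ?I)"
    have c: "0 < c" using e pos by (simp add: c_def)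
    define \<eta> :: "real^'n \<Rightarrow> real" where "\<eta> = (\<lambda>x. c * \<rho> ((1 / \<epsilon>) *\<^sub>R x))"
    have "has_partial i \<rho> (partial_deriv i \<rho>)" for i
      using smooth_fun_has_partial[OF sm, of i "[]"] by simp
    from has_partial_unique[OF has_partial_scale[OF this, of _ c "1 / \<epsilon>"]]
    have pd: "partial_deriv i \<eta> = (\<lambda>x. c * (1 / \<epsilon>) * partial_deriv i \<rho> ((1 / \<epsilon>) *\<^sub>R x))" for i
      by (simp add: \<eta>_def)
    have I: "integral UNIV (\<lambda>x. f ((1 / \<epsilon>) *\<^sub>R x)) = \<epsilon> ^ CARD('n) * integral UNIV f"
      if "ccont f" for f :: "real^'n \<Rightarrow> real"
      using integral_affine[OF that, of "1 / \<epsilon>" 0] e by (simp add: power_divide)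
    have "smooth_fun \<eta>" unfolding \<eta>_def by (rule smooth_fun_scale[OF sm])
    moreover have ze: "\<eta> x = 0" if "\<epsilon> < norm x" for x
      using z[of "(1 / \<epsilon>) *\<^sub>R x"] that e by (simp add: \<eta>_def)
    moreover have "ccont \<eta>"
      using smooth_fun_continuous[OF \<open>smooth_fun \<eta>\<close>, of "[]"] ze by (intro ccontI[of _ \<epsilon>]) auto
    moreover have "0 \<le> \<eta> x" "\<eta> (- x) = \<eta> x" for x
      using c nn ev[of "(1 / \<epsilon>) *\<^sub>R x"] by (simp_all add: \<eta>_def)
    moreover have "integral UNIV \<eta> = 1"
      using I[OF cc] e pos by (simp add: \<eta>_def c_def)
    moreover have "integral UNIV (\<lambda>z. \<bar>partial_deriv i \<eta> z\<bar>) \<le> ?C / \<epsilon>" for i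
    proof -
      have "integral UNIV (\<lambda>z. \<bar>partial_deriv i \<eta> z\<bar>) = c * (1 / \<epsilon>) * (\<epsilon> ^ CARD('n) * ?J i)"
        using I[OF cca[of i]] e c by (simp add: pd abs_mult)
      also have "\<dots> = ?J i / ?I / \<epsilon>" using e pos by (simp add: c_def field_simps)
      also have "\<dots> \<le> ?C / \<epsilon>"
        using e pos J by (intro divide_right_mono member_le_sum) auto
      finally show ?thesis .
    qed
    ultimately show "\<exists>\<eta>::real^'n \<Rightarrow> real. smooth_fun \<eta> \<and> ccont \<eta> \<and> (\<forall>z. 0 \<le> \<eta> z) \<and>
     (\<forall>z. \<eta> (- z) = \<eta> z) \<and> (\<forall>z. \<epsilon> < norm z \<longrightarrow> \<eta> z = 0) \<and> integral UNIV \<eta> = 1 \<and>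
     (\<forall>i. integral UNIV (\<lambda>z. \<bar>partial_deriv i \<eta> z\<bar>) \<le> ?C / \<epsilon>)"
      by blast
  qed
qed

section \<open>Estimates for mollified functions\<close>

lemma C1_on_subset: "C1_on T f \<Longrightarrow> S \<subseteq> T \<Longrightarrow> C1_on S f"
  unfolding C1_on_def by (meson continuous_on_subset subsetD)

lemma C2_on_subset: "C2_on T f \<Longrightarrow> S \<subseteq> T \<Longrightarrow> C2_on S f"
  unfolding C2_on_def by (meson C1_on_subset subsetD)

lemma C1_on_continuous_on: "C1_on S f \<Longrightarrow> continuous_on S f"
  unfolding C1_on_def
  by (meson continuous_at_imp_continuous_on has_derivative_continuous)

lemma C2_on_imp_C1_on: "C2_on S f \<Longrightarrow> C1_on S f"
  unfolding C2_on_def using C1_on_continuous_on by (auto simp: C1_on_def[of S f])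

lemma compact_norm_bound:
  fixes f :: "'a::topological_space \<Rightarrow> 'b::real_normed_vector"
  assumes "compact S" "continuous_on S f"
  shows "\<exists>L\<ge>0. \<forall>x\<in>S. norm (f x) \<le> L"
proof -
  have "bounded (f ` S)" using assms by (intro compact_imp_bounded compact_continuous_image)
  then obtain L where "\<forall>x\<in>S. norm (f x) \<le> L" by (auto simp: bounded_iff)
  then show ?thesis by (intro exI[of _ "max 0 L"]) auto
qed

text \<open>Compactness bounds the derivative and convexity allows the mean value inequality along
  segments.\<close>

lemma C1_on_lipschitz:
  fixes f :: "'a::real_normed_vector \<Rightarrow> 'b::real_normed_vector"
  assumes "C1_on C f" "compact C" "convex C"
  shows "\<exists>L\<ge>0. \<forall>v\<in>C. \<forall>w\<in>C. norm (f v - f w) \<le> L * norm (v - w)"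
proof -
  obtain f' :: "'a \<Rightarrow> 'a \<Rightarrow>\<^sub>L 'b" where f': "\<And>x. x \<in> C \<Longrightarrow> (f has_derivative f' x) (at x)"
    and cont: "continuous_on C f'"
    using assms(1) by (auto simp: C1_on_def)
  obtain L where L: "L \<ge> 0" "\<And>x. x \<in> C \<Longrightarrow> norm (f' x) \<le> L"
    using compact_norm_bound[OF assms(2) cont] by blast
  have "norm (f v - f w) \<le> L * norm (v - w)" if "v \<in> C" "w \<in> C" for v w
    by (rule differentiable_bound[OF assms(3), of f "\<lambda>x. f' x"])
      (use that L f' in \<open>auto simp: norm_blinfun.rep_eq[symmetric] intro: has_derivative_at_withinI\<close>)
  with L(1) show ?thesis by blast
qed

text \<open>The first derivative is Lipschitz on \<open>C\<close>, so along the segment from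
  \<open>w\<close> to \<open>v\<close> it differs from its value at \<open>w\<close> by at most
  \<open>L * norm (v - w)\<close>; the mean value inequality for \<open>f\<close> minus its
  linearisation adds the second factor. The remainder is written with
  \<open>frechet_derivative\<close> because the entropy relation is.\<close>

lemma C2_on_taylor:
  fixes f :: "'a::real_normed_vector \<Rightarrow> 'b::real_normed_vector"
  assumes "C2_on C f" "compact C" "convex C"
  shows "\<exists>L\<ge>0. \<forall>v\<in>C. \<forall>w\<in>C.
    norm (f v - f w - frechet_derivative f (at w) (v - w)) \<le> L * (norm (v - w))\<^sup>2"
proof -
  obtain f' :: "'a \<Rightarrow> 'a \<Rightarrow>\<^sub>L 'b" where f': "\<And>x. x \<in> C \<Longrightarrow> (f has_derivative f' x) (at x)"
    and C1: "C1_on C f'"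
    using assms(1) by (auto simp: C2_on_def)
  obtain L where L: "L \<ge> 0" "\<And>v w. v \<in> C \<Longrightarrow> w \<in> C \<Longrightarrow> norm (f' v - f' w) \<le> L * norm (v - w)"
    using C1_on_lipschitz[OF C1 assms(2,3)] by blast
  have "norm (f v - f w - frechet_derivative f (at w) (v - w)) \<le> L * (norm (v - w))\<^sup>2"
    if vw: "v \<in> C" "w \<in> C" for v w
  proof -
    have sub: "closed_segment w v \<subseteq> C" using assms(3) vw by (simp add: closed_segment_subset)
    have "norm (f v - f w - f' w (v - w)) \<le> norm (v - w) * (L * norm (v - w))"
    proof (rule differentiable_bound_linearization[where S = "closed_segment w v" and f' = "\<lambda>x. f' x"])
      show "w + t *\<^sub>R (v - w) \<in> closed_segment w v" if "t \<in> {0..1}" for t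
        using that by (auto simp: in_segment algebra_simps intro!: exI[of _ t])
      show "(f has_derivative f' x) (at x within closed_segment w v)" if "x \<in> closed_segment w v" for x
        using f' sub that by (auto intro: has_derivative_at_withinI)
      fix x assume x: "x \<in> closed_segment w v"
      have "onorm (blinfun_apply (f' x) - blinfun_apply (f' w)) = norm (f' x - f' w)"
        by (simp add: norm_blinfun.rep_eq minus_blinfun.rep_eq fun_diff_def)
      also have "\<dots> \<le> L * norm (x - w)" using L(2) x sub vw by blast
      also have "\<dots> \<le> L * norm (v - w)"
        using segment_bound1[OF x] L(1) by (intro mult_left_mono) auto
      finally show "onorm (blinfun_apply (f' x) - blinfun_apply (f' w)) \<le> L * norm (v - w)" .
    qed simp
    moreover have "frechet_derivative f (at w) = f' w"
      using frechet_derivative_at[OF f'[OF vw(2)]] by simp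
    ultimately show ?thesis by (simp add: power2_eq_square mult_ac)
  qed
  with L(1) show ?thesis by blast
qed

text \<open>Over a finite index type the sum of nonnegative constants dominates each of them, so
  constants found for each flux separately merge into one.\<close>

lemma ex_uniform_bound:
  fixes P :: "'n::finite \<Rightarrow> real \<Rightarrow> bool"
  assumes "\<And>i. \<exists>L\<ge>0. P i L" and mono: "\<And>i L L'. P i L \<Longrightarrow> L \<le> L' \<Longrightarrow> P i L'"
  shows "\<exists>L\<ge>0. \<forall>i. P i L"
proof -
  obtain L where L: "\<And>i. L i \<ge> 0" "\<And>i. P i (L i)" using assms(1) by metis
  have "L i \<le> (\<Sum>j\<in>UNIV. L j)" for i using L by (intro member_le_sum) auto
  then have "P i (\<Sum>j\<in>UNIV. L j)" for i by (rule mono[OF L(2)])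
  moreover have "0 \<le> (\<Sum>j\<in>UNIV. L j)" by (intro sum_nonneg L)
  ultimately show ?thesis by blast
qed

section \<open>Chain and product rules along coordinate axes\<close>

lemma has_partial_compose:
  assumes "has_partial i v v'" "\<And>x. (g has_derivative g' x) (at (v x))"
  shows "has_partial i (\<lambda>x. g (v x)) (\<lambda>x. g' x (v' x))"
  unfolding has_partial_def
proof
  fix x
  have "((\<lambda>t. v (x + t *\<^sub>R axis i 1)) has_vector_derivative v' x) (at 0)"
    using assms(1) by (simp add: has_partial_def)
  from vector_derivative_diff_chain_within[OF this, of g "g' x"]
    has_derivative_at_withinI[OF assms(2)[of x]]
  show "((\<lambda>t. g (v (x + t *\<^sub>R axis i 1))) has_vector_derivative g' x (v' x)) (at 0)"
    by (simp add: o_def)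
qed

lemma has_partial_inner:
  fixes f g :: "real^'n::finite \<Rightarrow> 'b::real_inner"
  assumes "has_partial i f f'" "has_partial i g g'"
  shows "has_partial i (\<lambda>x. f x \<bullet> g x) (\<lambda>x. f x \<bullet> g' x + f' x \<bullet> g x)"
  unfolding has_partial_def
proof
  fix x
  show "((\<lambda>t. f (x + t *\<^sub>R axis i 1) \<bullet> g (x + t *\<^sub>R axis i 1)) has_vector_derivative
      f x \<bullet> g' x + f' x \<bullet> g x) (at 0)"
    using bounded_bilinear.has_vector_derivative[OF bounded_bilinear_inner,
        of "\<lambda>t. f (x + t *\<^sub>R axis i 1)" "f' x" 0 UNIV "\<lambda>t. g (x + t *\<^sub>R axis i 1)" "g' x"] assms
    by (simp add: has_partial_def)
qed

lemma has_partial_diff: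
  assumes "has_partial i f f'" "has_partial i g g'"
  shows "has_partial i (\<lambda>x. f x - g x) (\<lambda>x. f' x - g' x)"
  using assms by (auto simp: has_partial_def intro: has_vector_derivative_diff)

lemma norm_integral_le_measure:
  fixes f :: "'a::euclidean_space \<Rightarrow> 'b::banach"
  assumes "\<And>x. x \<notin> cbox a b \<Longrightarrow> f x = 0" "continuous_on UNIV f" "\<And>x. norm (f x) \<le> c" "0 \<le> c"
  shows "norm (integral UNIV f) \<le> c * measure lborel (cbox a b)"
proof -
  have "f integrable_on cbox a b"
    using assms(2) by (intro integrable_continuous) (rule continuous_on_subset, auto)
  then show ?thesis
    using has_integral_bound[OF assms(4), of f "integral (cbox a b) f" a b] assms(1,3)
    by (subst integral_UNIV_restrict[of "cbox a b"]) auto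
qed

section \<open>Mollification at one point, bounded by the oscillation around it\<close>

context
  fixes \<eta> :: "real^'n::finite \<Rightarrow> real" and U :: "real^'n \<Rightarrow> 'v::euclidean_space" and x :: "real^'n"
    and \<epsilon> \<delta> :: real
  assumes U: "continuous_on UNIV U" and osc: "\<And>y. norm (x - y) \<le> \<epsilon> \<Longrightarrow> norm (U y - U x) \<le> \<delta>"
    and cc: "ccont \<eta>" and nn: "\<And>z. 0 \<le> \<eta> z" and one: "integral UNIV \<eta> = 1"
    and supp: "\<And>z. \<epsilon> < norm z \<Longrightarrow> \<eta> z = 0"
begin

lemma osc_supp: "\<eta> (x - y) \<noteq> 0 \<Longrightarrow> norm (U y - U x) \<le> \<delta>"
  using osc supp by (meson not_le)

lemma conv_close: "norm (conv \<eta> U x - U x) \<le> \<delta>"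
proof -
  have "conv \<eta> U x - U x = conv \<eta> (\<lambda>y. U y - U x) x"
    using conv_diff[OF cc U continuous_on_const, of "U x" x] conv_const[OF cc, of "U x" x] one by simp
  also have "norm \<dots> \<le> integral UNIV (\<lambda>z. \<bar>\<eta> z\<bar>) * \<delta>"
    by (rule norm_conv_le[OF cc]) (auto intro!: continuous_intros U osc_supp)
  finally show ?thesis using one nn by simp
qed

text \<open>The kernel derivative integrates to zero, so the constant \<open>U x\<close> may be
  subtracted at no cost. This replaces the size of \<open>U\<close> by its oscillation and is the
  source of the factor \<delta>/\<epsilon>.\<close>

lemma conv_partial_bound:
  assumes p: "has_partial i \<eta> \<eta>'" and c: "continuous_on UNIV \<eta>'"
  shows "norm (conv \<eta>' U x) \<le> integral UNIV (\<lambda>z. \<bar>\<eta>' z\<bar>) * \<delta>"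
proof -
  have cc': "ccont \<eta>'" by (rule has_partial_ccont[OF p cc c])
  have "\<eta>' z = 0" if "\<epsilon> < norm z" for z
    by (rule has_partial_zero[OF p, of "{z. \<epsilon> < norm z}"])
      (use that supp in \<open>auto intro!: open_Collect_less continuous_intros\<close>)
  then have le: "norm (U y - U x) \<le> \<delta>" if "\<eta>' (x - y) \<noteq> 0" for y
    using osc that by (meson not_le)
  have "conv \<eta>' U x = conv \<eta>' (\<lambda>y. U y - U x) x"
    using conv_diff[OF cc' U continuous_on_const, of "U x" x] conv_const[OF cc', of "U x" x]
      integral_partial_zero[OF p cc c] by simp
  also have "norm \<dots> \<le> integral UNIV (\<lambda>z. \<bar>\<eta>' z\<bar>) * \<delta>"
    by (rule norm_conv_le[OF cc']) (auto intro!: continuous_intros U le)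
  finally show ?thesis .
qed

text \<open>The expansion point is the average \<open>conv \<eta> U x\<close> and not
  \<open>U x\<close>: only then does the linear term integrate to exactly zero, leaving a remainder
  that is quadratic in the oscillation.\<close>

lemma conv_commutator_bound:
  fixes F :: "'v \<Rightarrow> 'w::euclidean_space"
  assumes C: "\<And>y. U y \<in> C" "convex C" "compact C" and F: "continuous_on C F" and L: "L \<ge> 0"
    and D: "bounded_linear D"
    and taylor: "\<And>v. v \<in> C \<Longrightarrow> norm (F v - F (conv \<eta> U x) - D (v - conv \<eta> U x)) \<le> L * (norm (v - conv \<eta> U x))\<^sup>2"
  shows "norm (conv \<eta> (\<lambda>y. F (U y)) x - F (conv \<eta> U x)) \<le> L * (2 * \<delta>)\<^sup>2"
proof -
  let ?v = "conv \<eta> U x"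
  have FU: "continuous_on UNIV (\<lambda>y. F (U y))"
    by (rule continuous_on_compose2[OF F U]) (use C in auto)
  have UD: "continuous_on UNIV (\<lambda>y. U y - ?v)" by (intro continuous_intros U)
  have DU: "continuous_on UNIV (\<lambda>y. D (U y - ?v))"
    by (rule bounded_linear.continuous_on[OF D UD])
  have FUv: "continuous_on UNIV (\<lambda>y. F (U y) - F ?v)" by (intro continuous_intros FU)
  \<comment> \<open>\<open>D\<close> commutes with the average, and the average of
    \<open>U y - ?v\<close> is zero because the kernel has mass one.\<close>
  have "conv \<eta> (\<lambda>y. D (U y - ?v)) x = D (?v - ?v)"
    using conv_linear[OF cc UD D] conv_diff[OF cc U continuous_on_const, of ?v x]
      conv_const[OF cc, of ?v x] one by simp
  then have "conv \<eta> (\<lambda>y. F (U y)) x - F ?v = conv \<eta> (\<lambda>y. F (U y) - F ?v - D (U y - ?v)) x"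
    using conv_diff[OF cc FUv DU, of x] conv_diff[OF cc FU continuous_on_const, of "F ?v" x]
      conv_const[OF cc, of "F ?v" x] one linear_0[OF bounded_linear.linear[OF D]] by simp
  also have "norm \<dots> \<le> integral UNIV (\<lambda>z. \<bar>\<eta> z\<bar>) * (L * (2 * \<delta>)\<^sup>2)"
  proof (rule norm_conv_le[OF cc])
    show "continuous_on UNIV (\<lambda>y. F (U y) - F ?v - D (U y - ?v))"
      by (intro continuous_on_diff FUv DU)
    fix y assume "\<eta> (x - y) \<noteq> 0"
    \<comment> \<open>One \<delta> is the distance from \<open>U y\<close> to \<open>U x\<close>,
      the other the distance from \<open>U x\<close> to the average.\<close>
    then have "norm (U y - ?v) \<le> 2 * \<delta>"
      using osc_supp conv_close norm_triangle_ineq4[of "U y - U x" "?v - U x"] by fastforce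
    then have "L * (norm (U y - ?v))\<^sup>2 \<le> L * (2 * \<delta>)\<^sup>2"
      using L by (intro mult_left_mono power_mono) auto
    then show "norm (F (U y) - F ?v - D (U y - ?v)) \<le> L * (2 * \<delta>)\<^sup>2"
      using taylor[OF C(1)[of y]] by linarith
  qed
  finally show ?thesis using one nn by simp
qed

end

section \<open>The entropy flux\<close>

text \<open>Here the entropy relation enters. In the derivative of w . F(v) - \<phi> q(v) the terms
  \<phi> B(v) . F'(v) v' cancel, leaving exactly the difference of the two integrands; that function
  has compact support, so the difference integrates to zero. Only first derivatives of
  \<open>v\<close> occur.\<close>

lemma integral_entropy_flux:
  fixes \<phi> :: "real^'n::finite \<Rightarrow> real" and v :: "real^'n \<Rightarrow> 'v::euclidean_space"
    and F :: "'v \<Rightarrow> 'w::euclidean_space" and B :: "'v \<Rightarrow> 'w" and q :: "'v \<Rightarrow> real"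
  assumes \<phi>: "ccont \<phi>" "has_partial i \<phi> \<phi>'" "continuous_on UNIV \<phi>'"
    and v: "continuous_on UNIV v" "has_partial i v v'" "continuous_on UNIV v'" "\<And>x. v x \<in> C"
    and B: "\<And>x. x \<in> C \<Longrightarrow> (B has_derivative blinfun_apply (B' x)) (at x)" "continuous_on C B'"
    and F: "\<And>x. x \<in> C \<Longrightarrow> (F has_derivative F' x) (at x)"
    and q: "\<And>x. x \<in> C \<Longrightarrow> (q has_derivative (\<lambda>y. B x \<bullet> F' x y)) (at x)"
  defines "w \<equiv> (\<lambda>x. \<phi> x *\<^sub>R B (v x))" and "w' \<equiv> (\<lambda>x. \<phi> x *\<^sub>R B' (v x) (v' x) + \<phi>' x *\<^sub>R B (v x))"
  shows "ccont w" "has_partial i w w'" "continuous_on UNIV w'"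
    "integral UNIV (\<lambda>x. w' x \<bullet> F (v x)) = integral UNIV (\<lambda>x. \<phi>' x * q (v x))"
proof -
  have cc': "ccont \<phi>'" by (rule has_partial_ccont[OF \<phi>(2,1,3)])
  have cB: "continuous_on C B"
    using B(1) by (meson continuous_at_imp_continuous_on has_derivative_continuous)
  have cF: "continuous_on C F"
    using F by (meson continuous_at_imp_continuous_on has_derivative_continuous)
  have cq: "continuous_on C q"
    using q by (meson continuous_at_imp_continuous_on has_derivative_continuous)
  have comp: "continuous_on UNIV (\<lambda>x. g (v x))" if "continuous_on C g" for g :: "'v \<Rightarrow> 'z::topological_space"
    by (rule continuous_on_compose2[OF that v(1)]) (use v(4) in auto)
  have c\<phi>: "continuous_on UNIV \<phi>" by (rule ccont_continuous[OF \<phi>(1)])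
  have cw: "continuous_on UNIV w"
    unfolding w_def by (intro continuous_on_scaleR c\<phi> comp cB)
  then show w: "ccont w"
    by (rule ccont_compose[OF \<phi>(1)]) (simp add: w_def)
  show pw: "has_partial i w w'"
    unfolding w_def w'_def by (intro has_partial_scaleR \<phi> has_partial_compose[OF v(2)] B(1) v(4))
  show cw': "continuous_on UNIV w'"
    unfolding w'_def by (intro continuous_on_add continuous_on_scaleR c\<phi> \<phi>(3) comp cB
        bounded_bilinear.continuous_on[OF bounded_bilinear_blinfun_apply] B(2) v(3))
  have w': "ccont w'" by (rule has_partial_ccont[OF pw w cw'])
  have pF: "has_partial i (\<lambda>x. F (v x)) (\<lambda>x. F' (v x) (v' x))"
    by (intro has_partial_compose[OF v(2)] F v(4))
  have pq: "has_partial i (\<lambda>x. q (v x)) (\<lambda>x. B (v x) \<bullet> F' (v x) (v' x))"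
    using has_partial_compose[OF v(2) q[OF v(4)]] .
  \<comment> \<open>The cancellation: differentiating \<open>F (v x)\<close> against
    \<open>w\<close> and differentiating \<open>q (v x)\<close> against \<open>\<phi>\<close>
    produce the same term.\<close>
  have h': "has_partial i (\<lambda>x. w x \<bullet> F (v x) - \<phi> x *\<^sub>R q (v x)) (\<lambda>x. w' x \<bullet> F (v x) - \<phi>' x * q (v x))"
    using has_partial_diff[OF has_partial_inner[OF pw pF] has_partial_scaleR[OF \<phi>(2) pq]]
    by (simp add: w_def)
  have c1: "ccont (\<lambda>x. w' x \<bullet> F (v x))"
    by (rule ccont_compose[OF w']) (auto intro!: continuous_on_inner cw' comp cF)
  have c2: "ccont (\<lambda>x. \<phi>' x * q (v x))"
    by (rule ccont_compose[OF cc']) (auto intro!: continuous_on_mult \<phi>(3) comp cq)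
  have "ccont (\<lambda>x. w x \<bullet> F (v x) - \<phi> x *\<^sub>R q (v x))"
    by (rule ccont_compose[OF \<phi>(1)])
      (auto simp: w_def intro!: continuous_intros c\<phi> comp cF cq cB)
  then have "integral UNIV (\<lambda>x. w' x \<bullet> F (v x) - \<phi>' x * q (v x)) = 0"
    by (rule integral_partial_zero[OF h'])
      (intro continuous_on_diff ccont_continuous[OF c1] ccont_continuous[OF c2])
  then show "integral UNIV (\<lambda>x. w' x \<bullet> F (v x)) = integral UNIV (\<lambda>x. \<phi>' x * q (v x))"
    by (simp add: integral_diff ccont_integrable[OF c1] ccont_integrable[OF c2])
qed

text \<open>The constant is fixed before \<open>\<epsilon>\<close> and \<open>\<delta>\<close>, so
  the rate can be chosen later. The summand \<delta> is the cost of replacing q(U) by q(v);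
  \<delta>/\<epsilon> + 1 bounds the derivative of \<phi> B(v), and \<delta>^2 the commutator.
  Oscillation is measured only around points of \<open>K\<close>, since \<open>\<phi>\<close> and
  its derivatives vanish elsewhere; the weak identity is needed for tests supported within distance
  \<open>r\<close> of \<open>K\<close>, because mollifying enlarges the support by at most
  \<epsilon> \<le> r.\<close>

lemma entropy_residual_bound:
  fixes \<phi> :: "real^'n::finite \<Rightarrow> real" and U :: "real^'n \<Rightarrow> 'v::euclidean_space"
    and A :: "'n \<Rightarrow> 'v \<Rightarrow> 'w::euclidean_space" and B :: "'v \<Rightarrow> 'w" and q :: "'n \<Rightarrow> 'v \<Rightarrow> real"
  assumes \<phi>: "smooth_fun \<phi>" and K: "compact K" and \<phi>K: "\<And>x. x \<notin> K \<Longrightarrow> \<phi> x = 0"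
    and U: "continuous_on UNIV U" "\<And>x. U x \<in> C" and C: "compact C" "convex C"
    and B: "C1_on C B" and A: "\<And>i. C2_on C (A i)" and q: "\<And>i. C1_on C (q i)"
    and dq: "\<And>i v. v \<in> C \<Longrightarrow> (q i has_derivative (\<lambda>w. B v \<bullet> frechet_derivative (A i) (at v) w)) (at v)"
    and weak: "\<And>\<psi>. smooth_fun \<psi> \<Longrightarrow> ccont \<psi> \<Longrightarrow> (\<And>x. (\<And>y. y \<in> K \<Longrightarrow> r < norm (x - y)) \<Longrightarrow> \<psi> x = 0) \<Longrightarrow>
       (\<Sum>i\<in>UNIV. integral UNIV (\<lambda>x. partial_deriv i \<psi> x \<bullet> A i (U x))) = 0"
  shows "\<exists>E. \<forall>\<epsilon> \<delta>. 0 < \<epsilon> \<longrightarrow> \<epsilon> \<le> r \<longrightarrow> 0 \<le> \<delta> \<longrightarrow>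
      (\<forall>x\<in>K. \<forall>y. norm (x - y) \<le> \<epsilon> \<longrightarrow> norm (U y - U x) \<le> \<delta>) \<longrightarrow>
      \<bar>\<Sum>i\<in>UNIV. integral UNIV (\<lambda>x. partial_deriv i \<phi> x * q i (U x))\<bar> \<le> E * (\<delta> + (\<delta> / \<epsilon> + 1) * \<delta>\<^sup>2)"
proof -
  obtain R where R: "\<And>x. x \<in> K \<Longrightarrow> norm x \<le> R"
    using compact_imp_bounded[OF K] by (auto simp: bounded_iff)
  obtain a b where ab: "\<And>x::real^'n. norm x \<le> R \<Longrightarrow> x \<in> cbox a b" using ex_cbox_norm_le by metis
  have Kab: "x \<notin> K" if "x \<notin> cbox a b" for x using R ab that by blast
  have c\<phi>: "ccont \<phi>"
    using smooth_fun_continuous[OF \<phi>, of "[]"] R \<phi>K by (intro ccontI[of _ R]) (auto, meson not_le)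
  have p\<phi>: "has_partial i \<phi> (partial_deriv i \<phi>)" for i
    using smooth_fun_has_partial[OF \<phi>, of i "[]"] by simp
  have cp: "continuous_on UNIV (partial_deriv i \<phi>)" for i
    using smooth_fun_continuous[OF \<phi>, of "[i]"] by simp
  have oK: "open (- K)" using compact_imp_closed[OF K] by (rule open_Compl)
  have p\<phi>K: "partial_deriv i \<phi> x = 0" if "x \<notin> K" for i x
    by (rule has_partial_zero[OF p\<phi> oK]) (use \<phi>K that in auto)
  \<comment> \<open>All integrands to be estimated vanish off \<open>K\<close>, so sup bounds on
    \<open>K\<close> times the volume of this fixed box bound the integrals.\<close>
  define V where "V = measure lborel (cbox a b)"
  have V: "0 \<le> V" by (simp add: V_def)
  obtain P0 where P0: "P0 \<ge> 0" "\<And>x. x \<in> K \<Longrightarrow> norm (\<phi> x) \<le> P0"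
    using compact_norm_bound[OF K ccont_continuous[OF c\<phi>]] by blast
  have "\<exists>P\<ge>0. \<forall>i. \<forall>x\<in>K. norm (partial_deriv i \<phi> x) \<le> P"
    by (rule ex_uniform_bound) (use compact_norm_bound[OF K continuous_on_subset[OF cp]] in fastforce)+
  then obtain P1 where P1: "P1 \<ge> 0" "\<And>i x. x \<in> K \<Longrightarrow> norm (partial_deriv i \<phi> x) \<le> P1" by blast
  define P where "P = max P0 P1"
  have P: "P \<ge> 0" "\<And>x. x \<in> K \<Longrightarrow> norm (\<phi> x) \<le> P" "\<And>i x. x \<in> K \<Longrightarrow> norm (partial_deriv i \<phi> x) \<le> P"
    unfolding P_def using P0 P1 by (auto simp: le_max_iff_disj simp del: real_norm_def)
  obtain B' where B': "\<And>x. x \<in> C \<Longrightarrow> (B has_derivative blinfun_apply (B' x)) (at x)" "continuous_on C B'"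
    using B by (auto simp: C1_on_def)
  obtain Bs where Bs: "Bs \<ge> 0" "\<And>v. v \<in> C \<Longrightarrow> norm (B v) \<le> Bs"
    using compact_norm_bound[OF C(1) C1_on_continuous_on[OF B]] by blast
  obtain Bn where Bn: "Bn \<ge> 0" "\<And>v. v \<in> C \<Longrightarrow> norm (B' v) \<le> Bn"
    using compact_norm_bound[OF C(1) B'(2)] by blast
  have "\<exists>L\<ge>0. \<forall>i. \<forall>v\<in>C. \<forall>w\<in>C. norm (q i v - q i w) \<le> L * norm (v - w)"
    by (rule ex_uniform_bound) (use C1_on_lipschitz[OF q C] in \<open>blast, meson mult_right_mono norm_ge_zero order_trans\<close>)
  then obtain Lq where Lq: "Lq \<ge> 0" "\<And>i v w. v \<in> C \<Longrightarrow> w \<in> C \<Longrightarrow> norm (q i v - q i w) \<le> Lq * norm (v - w)"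
    by blast
  have "\<exists>L\<ge>0. \<forall>i. \<forall>v\<in>C. \<forall>w\<in>C. norm (A i v - A i w - frechet_derivative (A i) (at w) (v - w)) \<le> L * (norm (v - w))\<^sup>2"
    by (rule ex_uniform_bound) (use C2_on_taylor[OF A C] in \<open>blast, meson mult_right_mono zero_le_power2 order_trans\<close>)
  then obtain LA where LA: "LA \<ge> 0" "\<And>i v w. v \<in> C \<Longrightarrow> w \<in> C \<Longrightarrow>
      norm (A i v - A i w - frechet_derivative (A i) (at w) (v - w)) \<le> LA * (norm (v - w))\<^sup>2"
    by blast
  obtain Ce where Ce: "Ce \<ge> 0" and moll: "\<And>\<epsilon>. \<epsilon> > 0 \<Longrightarrow> \<exists>\<eta>::real^'n \<Rightarrow> real. smooth_fun \<eta> \<and> ccont \<eta> \<and> (\<forall>z. 0 \<le> \<eta> z) \<and>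
     (\<forall>z. \<eta> (- z) = \<eta> z) \<and> (\<forall>z. \<epsilon> < norm z \<longrightarrow> \<eta> z = 0) \<and> integral UNIV \<eta> = 1 \<and>
     (\<forall>i. integral UNIV (\<lambda>z. \<bar>partial_deriv i \<eta> z\<bar>) \<le> Ce / \<epsilon>)"
    using ex_mollifier by blast
  have dA: "(A i has_derivative frechet_derivative (A i) (at v)) (at v)" if "v \<in> C" for i v
    using A[of i] that frechet_derivative_works unfolding C2_on_def by (meson differentiableI)
  have cA: "continuous_on C (A i)" for i
    using C1_on_continuous_on[OF C2_on_imp_C1_on[OF A]] .
  have cq: "continuous_on C (q i)" for i
    using C1_on_continuous_on[OF q] .
  \<comment> \<open>The cardinality comes from summing over the fluxes and the 4 from squaring the
    oscillation bound 2\<delta>. \<open>Bn * Ce\<close> belongs to the derivative of B(v), and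
    \<open>Bs\<close> to the derivative falling on \<open>\<phi>\<close>.\<close>
  define E where "E = real CARD('n) * (V * P * (Lq + 4 * LA * (Bn * Ce + Bs)))"
  show ?thesis
  proof (intro exI[of _ E] allI impI)
    fix \<epsilon> \<delta> :: real
    assume e: "0 < \<epsilon>" "\<epsilon> \<le> r" and d: "0 \<le> \<delta>"
      and osc: "\<forall>x\<in>K. \<forall>y. norm (x - y) \<le> \<epsilon> \<longrightarrow> norm (U y - U x) \<le> \<delta>"
    obtain \<eta> :: "real^'n \<Rightarrow> real" where sm: "smooth_fun \<eta>" and cc: "ccont \<eta>" and nn: "\<And>z. 0 \<le> \<eta> z"
      and ev: "\<And>z. \<eta> (- z) = \<eta> z" and supp: "\<And>z. \<epsilon> < norm z \<Longrightarrow> \<eta> z = 0" and one: "integral UNIV \<eta> = 1"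
      and L1: "\<And>i. integral UNIV (\<lambda>z. \<bar>partial_deriv i \<eta> z\<bar>) \<le> Ce / \<epsilon>"
      using moll[OF e(1)] by blast
    have p\<eta>: "has_partial i \<eta> (partial_deriv i \<eta>)" for i
      using smooth_fun_has_partial[OF sm, of i "[]"] by simp
    have cp\<eta>: "continuous_on UNIV (partial_deriv i \<eta>)" for i
      using smooth_fun_continuous[OF sm, of "[i]"] by simp
    have ccp\<eta>: "ccont (partial_deriv i \<eta>)" for i
      by (rule has_partial_ccont[OF p\<eta> cc cp\<eta>])
    define v where "v = conv \<eta> U"
    define v' where "v' i = conv (partial_deriv i \<eta>) U" for i
    have vC: "v x \<in> C" for x
      unfolding v_def by (rule conv_in_convex[OF cc nn one U(1) C(2) compact_imp_closed[OF C(1)] U(2)])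
    have cv: "continuous_on UNIV v" unfolding v_def by (rule continuous_on_conv[OF cc U(1)])
    have cv': "continuous_on UNIV (v' i)" for i
      unfolding v'_def by (rule continuous_on_conv[OF ccp\<eta> U(1)])
    have pv: "has_partial i v (v' i)" for i
      unfolding v_def v'_def by (rule has_partial_conv_left[OF cc p\<eta> cp\<eta> U(1)])
    define w where "w = (\<lambda>x. \<phi> x *\<^sub>R B (v x))"
    define w' where "w' i = (\<lambda>x. \<phi> x *\<^sub>R B' (v x) (v' i x) + partial_deriv i \<phi> x *\<^sub>R B (v x))" for i
    note flux = integral_entropy_flux[OF c\<phi> p\<phi> cp cv pv cv' vC B' dA dq, folded w_def, folded w'_def]
    have cw: "ccont w" and pw: "has_partial i w (w' i)" and cw': "continuous_on UNIV (w' i)" for i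
      using flux by auto
    \<comment> \<open>In the preceding facts the direction of differentiation and the index of the
      flux are independent; the divergence requires the diagonal instance.\<close>
    have fl: "integral UNIV (\<lambda>x. w' i x \<bullet> A i (v x)) = integral UNIV (\<lambda>x. partial_deriv i \<phi> x * q i (v x))" for i
      using flux(4)[of i i] by (simp add: w'_def)
    have ccw': "ccont (w' i)" for i by (rule has_partial_ccont[OF pw cw cw'])
    have w'K: "w' i x = 0" if "x \<notin> K" for i x using \<phi>K p\<phi>K that by (simp add: w'_def)
    define \<psi> where "\<psi> = conv \<eta> w"
    \<comment> \<open>The derivative is moved from the kernel to \<open>w\<close>: the estimate
      needs the size of \<open>w' i\<close>, and the outer convolution stays free to be transferred
      to the fluxes.\<close>
    have "partial_deriv i \<psi> = conv \<eta> (w' i)" for i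
      using has_partial_unique[OF has_partial_conv_left[OF cc p\<eta> cp\<eta> ccont_continuous[OF cw]]]
        conv_partial_swap[OF cc p\<eta> cp\<eta> ccont_continuous[OF cw] pw cw']
      unfolding \<psi>_def by (metis ext)
    moreover have "(\<Sum>i\<in>UNIV. integral UNIV (\<lambda>x. partial_deriv i \<psi> x \<bullet> A i (U x))) = 0"
    proof (rule weak)
      show "smooth_fun \<psi>" unfolding \<psi>_def by (rule smooth_fun_conv[OF sm cc ccont_continuous[OF cw]])
      show "ccont \<psi>" unfolding \<psi>_def by (rule ccont_conv[OF cc cw])
      fix x assume x: "\<And>y. y \<in> K \<Longrightarrow> r < norm (x - y)"
      show "\<psi> x = 0" unfolding \<psi>_def
      proof (rule conv_eq_0)
        fix y show "\<eta> (x - y) = 0 \<or> w y = 0"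
          using x[of y] supp[of "x - y"] e \<phi>K[of y] by (cases "y \<in> K") (auto simp: w_def)
      qed
    qed
    moreover have cAU: "continuous_on UNIV (\<lambda>x. A i (U x))" for i
      by (rule continuous_on_compose2[OF cA U(1)]) (use U(2) in auto)
    \<comment> \<open>Self-adjointness of the convolution turns the weak identity for
      \<open>\<psi>\<close> into one that pairs \<open>w' i\<close> with the mollified flux.\<close>
    ultimately have zero: "(\<Sum>i\<in>UNIV. integral UNIV (\<lambda>x. w' i x \<bullet> conv \<eta> (\<lambda>y. A i (U y)) x)) = 0"
      using integral_conv_inner_swap[OF cc ev ccw' cAU] by simp
    have cAv: "continuous_on UNIV (\<lambda>x. A i (v x))" for i
      by (rule continuous_on_compose2[OF cA cv]) (use vC in auto)
    have cqU: "continuous_on UNIV (\<lambda>x. q i (U x))" for i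
      by (rule continuous_on_compose2[OF cq U(1)]) (use U(2) in auto)
    have cqv: "continuous_on UNIV (\<lambda>x. q i (v x))" for i
      by (rule continuous_on_compose2[OF cq cv]) (use vC in auto)
    have ccAU: "continuous_on UNIV (conv \<eta> (\<lambda>y. A i (U y)))" for i
      by (rule continuous_on_conv[OF cc cAU])
    have oscx: "norm (U y - U x) \<le> \<delta>" if "x \<in> K" "norm (x - y) \<le> \<epsilon>" for x y using osc that by blast
    \<comment> \<open>\<open>?c1\<close> is the bound on the derivative of \<open>\<phi>\<close>
      times the Lipschitz estimate for \<open>q i\<close>. In \<open>?c2\<close> the first factor
      bounds \<open>w' i\<close> and the second the commutator.\<close>
    let ?c1 = "P * (Lq * \<delta>)"
    let ?c2 = "(P * (Bn * (Ce / \<epsilon> * \<delta>)) + P * Bs) * (LA * (2 * \<delta>)\<^sup>2)"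
    have b1: "norm (integral UNIV (\<lambda>x. partial_deriv i \<phi> x * (q i (U x) - q i (v x)))) \<le> ?c1 * V" for i
      unfolding V_def
    proof (rule norm_integral_le_measure)
      show "partial_deriv i \<phi> x * (q i (U x) - q i (v x)) = 0" if "x \<notin> cbox a b" for x
        using Kab[OF that] p\<phi>K by simp
      show "norm (partial_deriv i \<phi> x * (q i (U x) - q i (v x))) \<le> ?c1" for x
      proof (cases "x \<in> K")
        case True
        have "norm (q i (U x) - q i (v x)) \<le> Lq * norm (v x - U x)"
          using Lq(2)[OF U(2) vC, of i x x] by (simp add: norm_minus_commute)
        also have "\<dots> \<le> Lq * \<delta>"
          unfolding v_def
          by (intro mult_left_mono Lq(1)) (rule conv_close[OF U(1) oscx[OF True] cc nn one supp])
        finally show ?thesis unfolding norm_mult using P(1) P(3)[OF True]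
          by (intro mult_mono) auto
      qed (use p\<phi>K P Lq d in simp)
      show "0 \<le> ?c1" using P Lq d by simp
    qed (intro continuous_on_mult continuous_on_diff cp cqU cqv)
    have b2: "norm (integral UNIV (\<lambda>x. w' i x \<bullet> (A i (v x) - conv \<eta> (\<lambda>y. A i (U y)) x))) \<le> ?c2 * V" for i
      unfolding V_def
    proof (rule norm_integral_le_measure)
      show "w' i x \<bullet> (A i (v x) - conv \<eta> (\<lambda>y. A i (U y)) x) = 0" if "x \<notin> cbox a b" for x
        using Kab[OF that] w'K by simp
      show c2: "0 \<le> ?c2" using P Bn Ce e d Bs LA by simp
      show "norm (w' i x \<bullet> (A i (v x) - conv \<eta> (\<lambda>y. A i (U y)) x)) \<le> ?c2" for x
      proof (cases "x \<in> K")
        case True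
        have "norm (v' i x) \<le> Ce / \<epsilon> * \<delta>"
        proof -
          have "norm (conv (partial_deriv i \<eta>) U x) \<le> integral UNIV (\<lambda>z. \<bar>partial_deriv i \<eta> z\<bar>) * \<delta>"
            by (rule conv_partial_bound[OF U(1) oscx[OF True] cc nn one supp p\<eta> cp\<eta>])
          then show ?thesis
            using mult_right_mono[OF L1[of i] d] unfolding v'_def by linarith
        qed
        then have "norm (B' (v x) (v' i x)) \<le> Bn * (Ce / \<epsilon> * \<delta>)"
          using Bn(1) Bn(2)[OF vC, of x] norm_blinfun[of "B' (v x)" "v' i x"]
          by (meson mult_mono norm_ge_zero order_trans)
        then have "norm (w' i x) \<le> P * (Bn * (Ce / \<epsilon> * \<delta>)) + P * Bs"
          unfolding w'_def using P(1) P(2)[OF True] P(3)[OF True, of i] Bs(2)[OF vC, of x]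
          by (intro norm_triangle_mono; unfold norm_scaleR; intro mult_mono) auto
        moreover have "norm (A i (v x) - conv \<eta> (\<lambda>y. A i (U y)) x) \<le> LA * (2 * \<delta>)\<^sup>2"
        proof -
          have "norm (conv \<eta> (\<lambda>y. A i (U y)) x - A i (conv \<eta> U x)) \<le> LA * (2 * \<delta>)\<^sup>2"
          proof (rule conv_commutator_bound[OF U(1) oscx[OF True] cc nn one supp U(2) C(2) C(1) cA LA(1)])
            show "bounded_linear (frechet_derivative (A i) (at (conv \<eta> U x)))"
              by (rule has_derivative_bounded_linear[OF dA[OF vC[unfolded v_def]]])
          qed (use LA(2)[OF _ vC[unfolded v_def]] in auto)
          then show ?thesis unfolding v_def by (simp add: norm_minus_commute)
        qed
        ultimately have "norm (w' i x) * norm (A i (v x) - conv \<eta> (\<lambda>y. A i (U y)) x) \<le> ?c2"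
          using P Bn Ce e d Bs by (intro mult_mono) auto
        then show ?thesis
          unfolding real_norm_def by (rule order_trans[OF Cauchy_Schwarz_ineq2])
      qed (use w'K c2 in simp)
    qed (intro continuous_on_inner continuous_on_diff cw' cAv ccAU)
    have i1: "integral UNIV (\<lambda>x. partial_deriv i \<phi> x * q i (U x)) =
        integral UNIV (\<lambda>x. partial_deriv i \<phi> x * q i (v x)) +
        integral UNIV (\<lambda>x. partial_deriv i \<phi> x * (q i (U x) - q i (v x)))" for i
    proof -
      have "ccont (\<lambda>x. partial_deriv i \<phi> x * q i (v x))" "ccont (\<lambda>x. partial_deriv i \<phi> x * (q i (U x) - q i (v x)))"
        by (rule ccont_compose[OF has_partial_ccont[OF p\<phi> c\<phi> cp, of i]];
            auto intro!: continuous_on_mult continuous_on_diff cp cqU cqv)+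
      from integral_add[OF this[THEN ccont_integrable]] show ?thesis by (simp add: algebra_simps)
    qed
    have i2: "integral UNIV (\<lambda>x. w' i x \<bullet> A i (v x)) =
        integral UNIV (\<lambda>x. w' i x \<bullet> conv \<eta> (\<lambda>y. A i (U y)) x) +
        integral UNIV (\<lambda>x. w' i x \<bullet> (A i (v x) - conv \<eta> (\<lambda>y. A i (U y)) x))" for i
    proof -
      have "ccont (\<lambda>x. w' i x \<bullet> conv \<eta> (\<lambda>y. A i (U y)) x)" "ccont (\<lambda>x. w' i x \<bullet> (A i (v x) - conv \<eta> (\<lambda>y. A i (U y)) x))"
        by (rule ccont_compose[OF ccw'[of i]];
            auto intro!: continuous_on_inner continuous_on_diff cw' cAv ccAU)+
      from integral_add[OF this[THEN ccont_integrable]] show ?thesis by (simp add: algebra_simps)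
    qed
    \<comment> \<open>Replace q(U) by q(v), pass to w' . A(v) by the flux identity, and subtract the
      mollified fluxes, whose contributions vanish only after summation over \<open>i\<close>. What
      remains are two error terms per index.\<close>
    have "(\<Sum>i\<in>UNIV. integral UNIV (\<lambda>x. partial_deriv i \<phi> x * q i (U x))) =
      (\<Sum>i\<in>UNIV. integral UNIV (\<lambda>x. w' i x \<bullet> (A i (v x) - conv \<eta> (\<lambda>y. A i (U y)) x)) +
        integral UNIV (\<lambda>x. partial_deriv i \<phi> x * (q i (U x) - q i (v x))))"
      using zero by (simp add: i1 fl[symmetric] i2 sum.distrib)
    also have "\<bar>\<dots>\<bar> \<le> of_nat (card (UNIV :: 'n set)) * (?c2 * V + ?c1 * V)"
      unfolding real_norm_def[symmetric]
      by (intro order_trans[OF norm_sum] sum_bounded_above norm_triangle_mono b1 b2)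
    also have "\<dots> \<le> E * (\<delta> + (\<delta> / \<epsilon> + 1) * \<delta>\<^sup>2)"
    proof -
      define s where "s = \<delta> / \<epsilon>"
      have s: "0 \<le> s" using e d by (simp add: s_def)
      have "Lq * \<delta> + (Bn * Ce * s + Bs) * (4 * LA * \<delta>\<^sup>2) \<le>
        (Lq + 4 * LA * (Bn * Ce + Bs)) * (\<delta> + (s + 1) * \<delta>\<^sup>2)"
      proof -
        \<comment> \<open>These are precisely the products by which the expanded right-hand side
          exceeds the left-hand side.\<close>
        have "0 \<le> Lq * ((s + 1) * \<delta>\<^sup>2) + 4 * LA * (Bn * Ce + Bs) * \<delta> + 4 * LA * (Bn * Ce + Bs * s) * \<delta>\<^sup>2"
          using s d Lq LA Bn Ce Bs by (intro add_nonneg_nonneg mult_nonneg_nonneg) auto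
        then show ?thesis by (simp add: algebra_simps)
      qed
      then have "real CARD('n) * (V * P) * (Lq * \<delta> + (Bn * Ce * s + Bs) * (4 * LA * \<delta>\<^sup>2)) \<le>
        real CARD('n) * (V * P) * ((Lq + 4 * LA * (Bn * Ce + Bs)) * (\<delta> + (s + 1) * \<delta>\<^sup>2))"
        using V P by (intro mult_left_mono) auto
      moreover have "?c2 * V + ?c1 * V = V * P * (Lq * \<delta> + (Bn * Ce * s + Bs) * (4 * LA * \<delta>\<^sup>2))"
        by (simp add: s_def algebra_simps power2_eq_square)
      ultimately show ?thesis by (simp add: E_def s_def mult.assoc)
    qed
    finally show "\<bar>\<Sum>i\<in>UNIV. integral UNIV (\<lambda>x. partial_deriv i \<phi> x * q i (U x))\<bar> \<le> E * (\<delta> + (\<delta> / \<epsilon> + 1) * \<delta>\<^sup>2)" .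
  qed
qed

section \<open>Localization near the support of the test function and passage to the limit\<close>

theorem theorem1:
  fixes Q :: "(real^'n::finite) set"
    and M :: "(real^'k::finite) set"
    and A :: "'n \<Rightarrow> real^'k \<Rightarrow> real^'l::finite"
    and u :: "real^'n \<Rightarrow> real^'k"
    and B :: "real^'k \<Rightarrow> real^'l"
    and q :: "'n \<Rightarrow> real^'k \<Rightarrow> real"
  assumes "open Q"
    and "bounded M" and "open M" and "convex M"
    and "\<And>i. C2_on M (A i)"
    and "\<And>x. x \<in> Q \<Longrightarrow> u x \<in> M"
    and "\<And>\<psi> :: real^'n \<Rightarrow> real^'l. test_fun Q \<psi> \<Longrightarrow>
           (LINT x:Q|lborel. (\<Sum>i\<in>UNIV. partial_deriv i \<psi> x \<bullet> A i (u x))) = 0"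
    and "C1_on M B"
    and "\<And>i. C2_on M (q i)"
    and "\<And>i v. v \<in> M \<Longrightarrow>
           (q i has_derivative (\<lambda>w. B v \<bullet> frechet_derivative (A i) (at v) w)) (at v)"
    and "\<And>K. compact K \<Longrightarrow> K \<subseteq> Q \<Longrightarrow> \<exists>\<alpha>. 1/3 < \<alpha> \<and> \<alpha> \<le> 1 \<and> holder_on \<alpha> K u"
  shows "\<And>\<phi> :: real^'n \<Rightarrow> real. test_fun Q \<phi> \<Longrightarrow>
           (LINT x:Q|lborel. (\<Sum>i\<in>UNIV. partial_deriv i \<phi> x * q i (u x))) = 0"
proof -
  fix \<phi> :: "real^'n \<Rightarrow> real"
  assume \<phi>: "test_fun Q \<phi>"
  define K where "K = fun_support \<phi>"
  have sm: "smooth_fun \<phi>" and K: "compact K" "K \<subseteq> Q"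
    using \<phi> by (auto simp: test_fun_def K_def)
  have \<phi>K: "\<phi> x = 0" if "x \<notin> K" for x
    using that closure_subset[of "{x. \<phi> x \<noteq> 0}"] by (auto simp: K_def fun_support_def)
  have p\<phi>: "has_partial i \<phi> (partial_deriv i \<phi>)" for i
    using smooth_fun_has_partial[OF sm, of i "[]"] by simp
  have p\<phi>K: "partial_deriv i \<phi> x = 0" if "x \<notin> K" for i x
    by (rule has_partial_zero[OF p\<phi>, of "- K"]) (use \<phi>K that K in \<open>auto simp: compact_imp_closed open_Compl\<close>)
  show "(LINT x:Q|lborel. (\<Sum>i\<in>UNIV. partial_deriv i \<phi> x * q i (u x))) = 0"
  proof (cases "K = {}")
    \<comment> \<open>Treated apart because an empty support would make \<open>C\<close> empty, and
      the extension of \<open>u\<close> needs a nonempty target.\<close>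
    case True
    then show ?thesis using p\<phi>K by (simp add: set_lebesgue_integral_def)
  next
    case False
    obtain e where e: "e > 0" "(\<Union>x\<in>K. ball x e) \<subseteq> Q"
      using compact_subset_open_imp_ball_epsilon_subset[OF K(1) assms(1) K(2)] by blast
    \<comment> \<open>Half of \<open>e\<close>, so that the closed \<open>r\<close>-neighbourhood
      \<open>K'\<close> of \<open>K\<close> is still inside \<open>Q\<close>; being a sum of compact
      sets, it is compact.\<close>
    define r where "r = e / 2"
    have r: "0 < r" "r < e" using e by (auto simp: r_def)
    define K' where "K' = {x + y | x y. x \<in> K \<and> y \<in> cball 0 r}"
    have K'I: "y \<in> K'" if "x \<in> K" "norm (x - y) \<le> r" for x y
      unfolding K'_def using that
      by (intro CollectI exI[of _ x] exI[of _ "y - x"]) (auto simp: norm_minus_commute)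
    have KK': "K \<subseteq> K'" using K'I r by (metis diff_self norm_zero less_imp_le subsetI)
    have K'c: "compact K'" unfolding K'_def by (intro compact_sums K compact_cball)
    have K'Q: "K' \<subseteq> Q"
    proof
      fix z assume "z \<in> K'"
      then obtain x where "x \<in> K" "norm (z - x) \<le> r" by (auto simp: K'_def)
      then have "x \<in> K" "z \<in> ball x e" using r by (auto simp: dist_norm norm_minus_commute)
      then show "z \<in> Q" using e by blast
    qed
    obtain \<alpha> H0 where \<alpha>: "1/3 < \<alpha>"
      and H0: "\<And>x y. x \<in> K' \<Longrightarrow> y \<in> K' \<Longrightarrow> dist (u x) (u y) \<le> H0 * dist x y powr \<alpha>"
      using assms(11)[OF K'c K'Q] unfolding holder_on_def by blast
    \<comment> \<open>\<open>holder_on\<close> does not fix the sign of its constant; nonnegativity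
      is needed for monotonicity in the distance and for an admissible \<delta>.\<close>
    define H where "H = \<bar>H0\<bar>"
    have H: "0 \<le> H" by (simp add: H_def)
    have hold: "dist (u x) (u y) \<le> H * \<epsilon> powr \<alpha>" if "x \<in> K'" "y \<in> K'" "dist x y \<le> \<epsilon>" for x y \<epsilon>
    proof -
      have "dist (u x) (u y) \<le> H * dist x y powr \<alpha>"
        using H0[OF that(1,2)] by (rule order_trans) (auto simp: H_def intro!: mult_right_mono)
      also have "\<dots> \<le> H * \<epsilon> powr \<alpha>"
        using that(3) \<alpha> H by (intro mult_left_mono powr_mono2) auto
      finally show ?thesis .
    qed
    have z: "((\<lambda>\<epsilon>::real. \<epsilon> powr \<beta>) \<longlongrightarrow> 0) (at_right 0)" if "0 < \<beta>" for \<beta>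
      by (rule tendsto_zero_powrI[of _ _ _ \<beta>])
        (use that in \<open>auto intro!: tendsto_eq_intros eventually_at_rightI[of 0 1]\<close>)
    have cu: "continuous_on K' u"
      unfolding continuous_on_def
    proof
      fix x assume x: "x \<in> K'"
      have "((\<lambda>y. H * dist x y powr \<alpha>) \<longlongrightarrow> 0) (at x within K')"
        by (rule tendsto_mult_right_zero, rule tendsto_zero_powrI[of _ _ _ \<alpha>])
          (use \<alpha> in \<open>auto intro!: tendsto_eq_intros\<close>)
      then show "(u \<longlongrightarrow> u x) (at x within K')"
        unfolding tendsto_dist_iff[of u]
        by (rule Lim_null_comparison[rotated])
          (use hold[of _ x] x in \<open>auto simp: eventually_at_filter dist_commute\<close>)
    qed
    \<comment> \<open>In finite dimension the convex hull of a compact set is compact, and it stays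
      inside \<open>M\<close> by convexity. It therefore keeps a positive distance from the boundary
      of \<open>M\<close>, if there is one.\<close>
    define C where "C = convex hull (u ` K')"
    have C: "compact C" "convex C"
      unfolding C_def by (intro compact_convex_hull compact_continuous_image cu K'c convex_convex_hull)+
    have CM: "C \<subseteq> M"
      unfolding C_def by (intro hull_minimal assms(4)) (use K'Q assms(6) in auto)
    have uC: "u ` K' \<subseteq> C" unfolding C_def by (rule hull_subset)
    have "C \<noteq> {}" using uC KK' False by auto
    \<comment> \<open>The Dugundji extension takes its values in the convex set \<open>C\<close>, so
      the fluxes may be composed with \<open>U\<close> everywhere and averages of \<open>U\<close>
      remain in \<open>C\<close>.\<close>
    then obtain U where U: "continuous_on UNIV U" "U ` UNIV \<subseteq> C" "\<And>x. x \<in> K' \<Longrightarrow> U x = u x"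
      by (rule Dugundji[OF C(2) _ _ cu uC, of UNIV]) (use K'c in \<open>auto intro: compact_imp_closed\<close>)
    have UC: "U x \<in> C" for x using U(2) by auto
    have cA: "continuous_on C (A i)" for i
      using C1_on_continuous_on[OF C2_on_imp_C1_on[OF C2_on_subset[OF assms(5) CM]]] .
    have cq: "continuous_on C (q i)" for i
      using C1_on_continuous_on[OF C2_on_imp_C1_on[OF C2_on_subset[OF assms(9) CM]]] .
    have cAU: "continuous_on UNIV (\<lambda>x. A i (U x))" for i
      by (rule continuous_on_compose2[OF cA U(1)]) (use UC in auto)
    have cqU: "continuous_on UNIV (\<lambda>x. q i (U x))" for i
      by (rule continuous_on_compose2[OF cq U(1)]) (use UC in auto)
    have weak: "(\<Sum>i\<in>UNIV. integral UNIV (\<lambda>x. partial_deriv i \<psi> x \<bullet> A i (U x))) = 0"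
      if \<psi>: "smooth_fun \<psi>" "ccont \<psi>" "\<And>x. (\<And>y. y \<in> K \<Longrightarrow> r < norm (x - y)) \<Longrightarrow> \<psi> x = 0"
      for \<psi> :: "real^'n \<Rightarrow> real^'l"
    proof -
      have \<psi>K': "\<psi> x = 0" if "x \<notin> K'" for x
        using \<psi>(3) K'I that by (metis norm_minus_commute not_le)
      then have "fun_support \<psi> \<subseteq> K'"
        unfolding fun_support_def by (intro closure_minimal compact_imp_closed K'c) auto
      then have "test_fun Q \<psi>"
        using K'Q K'c \<psi>(1) unfolding test_fun_def
        by (metis closed_Int_compact closed_closure fun_support_def inf.absorb1 subset_trans)
      note 0 = assms(7)[OF this]
      have p: "has_partial i \<psi> (partial_deriv i \<psi>)" for i
        using smooth_fun_has_partial[OF \<psi>(1), of i "[]"] by simp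
      have cp: "continuous_on UNIV (partial_deriv i \<psi>)" for i
        using smooth_fun_continuous[OF \<psi>(1), of "[i]"] by simp
      have pK': "partial_deriv i \<psi> x = 0" if "x \<notin> K'" for i x
        by (rule has_partial_zero[OF p, of "- K'"])
          (use \<psi>K' that K'c in \<open>auto simp: compact_imp_closed open_Compl\<close>)
      have cc: "ccont (\<lambda>x. partial_deriv i \<psi> x \<bullet> A i (U x))" for i
        by (rule ccont_compose[OF has_partial_ccont[OF p \<psi>(2) cp, of i]])
          (auto intro!: continuous_on_inner cp cAU)
      have "(LINT x:Q|lborel. (\<Sum>i\<in>UNIV. partial_deriv i \<psi> x \<bullet> A i (u x))) =
          integral UNIV (\<lambda>x. \<Sum>i\<in>UNIV. partial_deriv i \<psi> x \<bullet> A i (U x))"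
      proof (rule ccont_set_lebesgue_integral)
        \<comment> \<open>On \<open>K'\<close> the extension agrees with \<open>u\<close>, and off
          \<open>K'\<close> the derivatives of \<open>\<psi>\<close> vanish; so the extension does
          not affect the weak formulation.\<close>
        show "(\<Sum>i\<in>UNIV. partial_deriv i \<psi> x \<bullet> A i (u x)) = (\<Sum>i\<in>UNIV. partial_deriv i \<psi> x \<bullet> A i (U x))" for x
          using pK'[of x] U(3)[of x] by (cases "x \<in> K'") auto
        show "(\<Sum>i\<in>UNIV. partial_deriv i \<psi> x \<bullet> A i (U x)) = 0" if "x \<notin> Q" for x
          using pK'[of x] subsetD[OF K'Q, of x] that by (cases "x \<in> K'") auto
      qed (intro ccont_sum cc finite)
      also have "\<dots> = (\<Sum>i\<in>UNIV. integral UNIV (\<lambda>x. partial_deriv i \<psi> x \<bullet> A i (U x)))"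
        by (rule integral_sum) (auto intro: ccont_integrable cc)
      finally show ?thesis using 0 by simp
    qed
    let ?S = "\<Sum>i\<in>UNIV. integral UNIV (\<lambda>x. partial_deriv i \<phi> x * q i (U x))"
    obtain E where E: "\<And>\<epsilon> \<delta>. 0 < \<epsilon> \<Longrightarrow> \<epsilon> \<le> r \<Longrightarrow> 0 \<le> \<delta> \<Longrightarrow>
        (\<And>x y. x \<in> K \<Longrightarrow> norm (x - y) \<le> \<epsilon> \<Longrightarrow> norm (U y - U x) \<le> \<delta>) \<Longrightarrow>
        \<bar>?S\<bar> \<le> E * (\<delta> + (\<delta> / \<epsilon> + 1) * \<delta>\<^sup>2)"
      using entropy_residual_bound[OF sm K(1) \<phi>K U(1) UC C(1,2) C1_on_subset[OF assms(8) CM]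
          C2_on_subset[OF assms(5) CM] C2_on_imp_C1_on[OF C2_on_subset[OF assms(9) CM]]
          assms(10)[OF subsetD[OF CM]] weak, of r] by blast
    have bound: "\<bar>?S\<bar> \<le> E * (H * \<epsilon> powr \<alpha> + (H ^ 3 * \<epsilon> powr (3 * \<alpha> - 1) + H\<^sup>2 * \<epsilon> powr (2 * \<alpha>)))"
      if "0 < \<epsilon>" "\<epsilon> \<le> r" for \<epsilon>
    proof -
      \<comment> \<open>The choice is \<delta> = H \<epsilon>^\<alpha>. It is legitimate because an
        \<epsilon>-ball around a point of \<open>K\<close> lies in \<open>K'\<close> for \<epsilon>
        \<le> r, where \<open>U\<close> equals \<open>u\<close> and the Hoelder bound holds.\<close>
      have "\<bar>?S\<bar> \<le> E * (H * \<epsilon> powr \<alpha> + (H * \<epsilon> powr \<alpha> / \<epsilon> + 1) * (H * \<epsilon> powr \<alpha>)\<^sup>2)"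
      proof (rule E[OF that])
        fix x y assume "x \<in> K" "norm (x - y) \<le> \<epsilon>"
        then have "x \<in> K'" "y \<in> K'" "dist y x \<le> \<epsilon>"
          using KK' K'I that by (auto simp: dist_norm norm_minus_commute)
        then show "norm (U y - U x) \<le> H * \<epsilon> powr \<alpha>"
          using hold[of y x \<epsilon>] U(3) by (simp add: dist_norm)
      qed (use H in simp)
      moreover have "\<epsilon> powr \<alpha> / \<epsilon> * (\<epsilon> powr \<alpha>)\<^sup>2 = \<epsilon> powr (3 * \<alpha> - 1)" "(\<epsilon> powr \<alpha>)\<^sup>2 = \<epsilon> powr (2 * \<alpha>)"
        using that by (simp_all add: powr_diff powr_add[symmetric] power2_eq_square)
      moreover have "(H * \<epsilon> powr \<alpha> / \<epsilon> + 1) * (H * \<epsilon> powr \<alpha>)\<^sup>2 =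
          H ^ 3 * (\<epsilon> powr \<alpha> / \<epsilon> * (\<epsilon> powr \<alpha>)\<^sup>2) + H\<^sup>2 * (\<epsilon> powr \<alpha>)\<^sup>2"
        by (simp add: algebra_simps power2_eq_square power3_eq_cube)
      ultimately show ?thesis by (simp only:)
    qed
    have "((\<lambda>\<epsilon>. E * (H * \<epsilon> powr \<alpha> + (H ^ 3 * \<epsilon> powr (3 * \<alpha> - 1) + H\<^sup>2 * \<epsilon> powr (2 * \<alpha>)))) \<longlongrightarrow> 0) (at_right 0)"
      by (intro tendsto_mult_right_zero tendsto_add_zero z) (use \<alpha> in auto)
    moreover have "\<forall>\<^sub>F \<epsilon> in at_right 0. \<bar>?S\<bar> \<le> E * (H * \<epsilon> powr \<alpha> + (H ^ 3 * \<epsilon> powr (3 * \<alpha> - 1) + H\<^sup>2 * \<epsilon> powr (2 * \<alpha>)))"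
      using r(1) bound by (intro eventually_at_rightI[of 0 r]) auto
    \<comment> \<open>\<open>?S\<close> does not depend on \<epsilon>, so a bound that tends to 0
      forces it to vanish.\<close>
    ultimately have "\<bar>?S\<bar> \<le> 0"
      by (intro tendsto_lowerbound[where F = "at_right (0::real)"]) auto
    moreover have "(LINT x:Q|lborel. (\<Sum>i\<in>UNIV. partial_deriv i \<phi> x * q i (u x))) = ?S"
    proof -
      have c\<phi>: "ccont \<phi>"
      proof -
        obtain R where "\<And>x. x \<in> K \<Longrightarrow> norm x \<le> R"
          using compact_imp_bounded[OF K(1)] by (auto simp: bounded_iff)
        then show ?thesis
          using smooth_fun_continuous[OF sm, of "[]"] \<phi>K by (intro ccontI[of _ R]) (auto, meson not_le)
      qed
      have cp: "continuous_on UNIV (partial_deriv i \<phi>)" for i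
        using smooth_fun_continuous[OF sm, of "[i]"] by simp
      have cc: "ccont (\<lambda>x. partial_deriv i \<phi> x * q i (U x))" for i
        by (rule ccont_compose[OF has_partial_ccont[OF p\<phi> c\<phi> cp, of i]])
          (auto intro!: continuous_on_mult cp cqU)
      have "(LINT x:Q|lborel. (\<Sum>i\<in>UNIV. partial_deriv i \<phi> x * q i (u x))) =
          integral UNIV (\<lambda>x. \<Sum>i\<in>UNIV. partial_deriv i \<phi> x * q i (U x))"
      proof (rule ccont_set_lebesgue_integral)
        show "(\<Sum>i\<in>UNIV. partial_deriv i \<phi> x * q i (u x)) = (\<Sum>i\<in>UNIV. partial_deriv i \<phi> x * q i (U x))" for x
          using p\<phi>K[of x] U(3)[of x] KK' by (cases "x \<in> K") auto
        show "(\<Sum>i\<in>UNIV. partial_deriv i \<phi> x * q i (U x)) = 0" if "x \<notin> Q" for x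
          using p\<phi>K[of x] subsetD[OF K(2), of x] that by (cases "x \<in> K") auto
      qed (intro ccont_sum cc finite)
      also have "\<dots> = ?S"
        by (rule integral_sum) (auto intro: ccont_integrable cc)
      finally show ?thesis .
    qed
    ultimately show ?thesis by simp
  qed
qed

end
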